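(* Let $(X,K)$ be a simply connected null complete Lorentzian surface admitting a (complete, non-trivial) Killing field $K$, and let $R_f$ be a maximal ribbon in $X$. Then every geodesic contained in the semi-ribbon $R_{f|\mathbb{R}^+}$ with unbounded interval $I^+$ is complete if and only if for all $\epsilon\in\{\pm1\}$ such that $\sup_{\mathbb{R}^+}\epsilon f<+\infty$, one of the following holds ($\mu$ is the Lebesgue measure): - there exists $M>0$ such that $\mu(\{-\epsilon f\le M\}\cap\mathbb{R}^+)=\infty$; or - for all $M>0$, $\mu(\{-\epsilon f\le M\}\cap\mathbb{R}^+)<+\infty$, and there exists $\alpha>0$ such that $$\int_{\{-\epsilon f\ge\alpha\}\cap\mathbb{R}^+}\frac{dx}{\sqrt{-\epsilon f(x)}}=\infty.$$ In particular, if $f$ is bounded, these geodesics are complete.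
   Context: A Lorentzian surface is a smooth connected surface with a Lorentzian metric; null complete means all null geodesics are complete. A ribbon in $X$ is an open simply connected $K$-invariant subset on which $K$ does not vanish and such that one of the null foliations is everywhere transverse to $K$. A maximal ribbon of a null complete $X$ is isometric to $R_f=(\mathbb{R}\times\mathbb{R},\,2dxdy+f(x)dy^2)$ with $K=\partial_y$, $f\in C^\infty(\mathbb{R},\mathbb{R})$; $R_{f|\mathbb{R}^+}$ is the part $x\ge0$. A (semi-)geodesic $\gamma:[0,t^+_\infty[\to X$, maximal towards $t^+_\infty$, is contained in the semi-ribbon with unbounded $I^+$ if its image lies in $R_{f|\mathbb{R}^+}$ and $I^+=\{x(\gamma(t)):t\in[0,t^+_\infty[\}$ is unbounded; it is complete if $t^+_\infty=+\infty$. *)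

theory Defs
  imports "HOL-Analysis.Analysis"
begin

section \<open>Smooth maps between normed spaces\<close>

text \<open>Meaningful on open sets only: all derivatives are two-sided.\<close>

fun Ck_on :: "nat \<Rightarrow> 'a::real_normed_vector set \<Rightarrow> ('a \<Rightarrow> 'b::real_normed_vector) \<Rightarrow> bool" where
  "Ck_on 0 S h \<longleftrightarrow> continuous_on S h"
| "Ck_on (Suc k) S h \<longleftrightarrow>
     (\<forall>x\<in>S. h differentiable (at x)) \<and>
     (\<forall>v. Ck_on k S (\<lambda>x. frechet_derivative h (at x) v))"

definition smooth_on :: "'a::real_normed_vector set \<Rightarrow> ('a \<Rightarrow> 'b::real_normed_vector) \<Rightarrow> bool" where
  "smooth_on S h \<longleftrightarrow> (\<forall>k. Ck_on k S h)"

definition partial :: "2 \<Rightarrow> (real^2 \<Rightarrow> real) \<Rightarrow> real^2 \<Rightarrow> real" where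
  "partial i h z = frechet_derivative h (at z) (axis i 1)"


section \<open>Smooth surfaces\<close>

text \<open>A chart is a pair of a domain and a coordinate map. The values of the coordinate map off
  the domain are irrelevant; a maximal atlas contains all such variants of each of its charts.\<close>

type_synonym 'a chart = "'a set \<times> ('a \<Rightarrow> real^2)"

definition chart_inv :: "'a chart \<Rightarrow> real^2 \<Rightarrow> 'a" where
  "chart_inv c = inv_into (fst c) (snd c)"

definition is_chart :: "'a::topological_space chart \<Rightarrow> bool" where
  "is_chart c \<longleftrightarrow> open (fst c) \<and> open (snd c ` fst c) \<and>
     homeomorphism (fst c) (snd c ` fst c) (snd c) (chart_inv c)"

definition transition :: "'a chart \<Rightarrow> 'a chart \<Rightarrow> real^2 \<Rightarrow> real^2" where
  "transition c d = snd d \<circ> chart_inv c"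

definition compatible :: "'a chart \<Rightarrow> 'a chart \<Rightarrow> bool" where
  "compatible c d \<longleftrightarrow> smooth_on (snd c ` (fst c \<inter> fst d)) (transition c d) \<and>
                      smooth_on (snd d ` (fst c \<inter> fst d)) (transition d c)"

definition smooth_structure :: "'a::topological_space chart set \<Rightarrow> bool" where
  "smooth_structure A \<longleftrightarrow>
     (\<forall>c\<in>A. is_chart c) \<and> (\<forall>c\<in>A. \<forall>d\<in>A. compatible c d) \<and> (\<Union>c\<in>A. fst c) = UNIV \<and>
     (\<forall>c. is_chart c \<and> (\<forall>d\<in>A. compatible c d) \<longrightarrow> c \<in> A)"

definition transition_jacobian :: "'a chart \<Rightarrow> 'a chart \<Rightarrow> 'a \<Rightarrow> real^2^2" where
  "transition_jacobian c d p = jacobian (transition c d) (at (snd c p))"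


section \<open>Lorentzian surfaces and Killing fields\<close>

text \<open>Tensor fields are given by their components: \<open>g c p\<close> is the Gram matrix at \<open>p\<close> of the metric
  and \<open>K c p\<close> the component vector of the field, both with respect to the coordinate frame of the
  chart \<open>c\<close>. Component families obey the usual transformation laws; their values for \<open>p\<close> outside
  the domain of \<open>c\<close> are irrelevant.\<close>

definition bilin :: "real^2^2 \<Rightarrow> real^2 \<Rightarrow> real^2 \<Rightarrow> real" where
  "bilin G u v = u \<bullet> (G *v v)"

definition lorentzian_form :: "real^2^2 \<Rightarrow> bool" where
  "lorentzian_form G \<longleftrightarrow> transpose G = G \<and>
     (\<exists>u v. bilin G u u = -1 \<and> bilin G v v = 1 \<and> bilin G u v = 0)"

definition lorentzian_metric ::
    "'a::topological_space chart set \<Rightarrow> ('a chart \<Rightarrow> 'a \<Rightarrow> real^2^2) \<Rightarrow> bool" where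
  "lorentzian_metric A g \<longleftrightarrow>
     (\<forall>c\<in>A. smooth_on (snd c ` fst c) (g c \<circ> chart_inv c) \<and>
        (\<forall>p\<in>fst c. lorentzian_form (g c p))) \<and>
     (\<forall>c\<in>A. \<forall>d\<in>A. \<forall>p \<in> fst c \<inter> fst d.
        g c p = transpose (transition_jacobian c d p) ** g d p ** transition_jacobian c d p)"

definition lorentzian_surface ::
    "'a::{t2_space,second_countable_topology} chart set \<Rightarrow> ('a chart \<Rightarrow> 'a \<Rightarrow> real^2^2) \<Rightarrow> bool" where
  "lorentzian_surface A g \<longleftrightarrow>
     smooth_structure A \<and> connected (UNIV :: 'a set) \<and> lorentzian_metric A g"

definition smooth_vector_field ::
    "'a::topological_space chart set \<Rightarrow> ('a chart \<Rightarrow> 'a \<Rightarrow> real^2) \<Rightarrow> bool" where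
  "smooth_vector_field A K \<longleftrightarrow>
     (\<forall>c\<in>A. smooth_on (snd c ` fst c) (K c \<circ> chart_inv c)) \<and>
     (\<forall>c\<in>A. \<forall>d\<in>A. \<forall>p \<in> fst c \<inter> fst d. K d p = transition_jacobian c d p *v K c p)"

text \<open>The components of the Lie derivative of the metric along a vector field, in coordinates.\<close>

definition lie_metric ::
    "(real^2 \<Rightarrow> real^2) \<Rightarrow> (real^2 \<Rightarrow> real^2^2) \<Rightarrow> real^2 \<Rightarrow> 2 \<Rightarrow> 2 \<Rightarrow> real" where
  "lie_metric V G z i j =
     (\<Sum>k\<in>UNIV. V z $ k * partial k (\<lambda>w. G w $ i $ j) z
               + G z $ k $ j * partial i (\<lambda>w. V w $ k) z
               + G z $ i $ k * partial j (\<lambda>w. V w $ k) z)"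

definition killing_field ::
    "'a::topological_space chart set \<Rightarrow> ('a chart \<Rightarrow> 'a \<Rightarrow> real^2^2) \<Rightarrow> ('a chart \<Rightarrow> 'a \<Rightarrow> real^2) \<Rightarrow> bool" where
  "killing_field A g K \<longleftrightarrow> smooth_vector_field A K \<and>
     (\<forall>c\<in>A. \<forall>z \<in> snd c ` fst c. \<forall>i j. lie_metric (K c \<circ> chart_inv c) (g c \<circ> chart_inv c) z i j = 0)"

definition nontrivial_field :: "'a chart set \<Rightarrow> ('a chart \<Rightarrow> 'a \<Rightarrow> real^2) \<Rightarrow> bool" where
  "nontrivial_field A K \<longleftrightarrow> (\<exists>c\<in>A. \<exists>p\<in>fst c. K c p \<noteq> 0)"

definition integral_curve ::
    "'a::topological_space chart set \<Rightarrow> ('a chart \<Rightarrow> 'a \<Rightarrow> real^2) \<Rightarrow> (real \<Rightarrow> 'a) \<Rightarrow> bool" where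
  "integral_curve A K \<gamma> \<longleftrightarrow> continuous_on UNIV \<gamma> \<and>
     (\<forall>c\<in>A. \<forall>t. \<gamma> t \<in> fst c \<longrightarrow> ((snd c \<circ> \<gamma>) has_vector_derivative K c (\<gamma> t)) (at t))"

definition complete_field ::
    "'a::topological_space chart set \<Rightarrow> ('a chart \<Rightarrow> 'a \<Rightarrow> real^2) \<Rightarrow> bool" where
  "complete_field A K \<longleftrightarrow> (\<forall>p. \<exists>\<gamma>. integral_curve A K \<gamma> \<and> \<gamma> 0 = p)"

definition flow_invariant ::
    "'a::topological_space chart set \<Rightarrow> ('a chart \<Rightarrow> 'a \<Rightarrow> real^2) \<Rightarrow> 'a set \<Rightarrow> bool" where
  "flow_invariant A K U \<longleftrightarrow> (\<forall>\<gamma>. integral_curve A K \<gamma> \<and> \<gamma> 0 \<in> U \<longrightarrow> range \<gamma> \<subseteq> U)"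


section \<open>Geodesics\<close>

definition christoffel :: "(real^2 \<Rightarrow> real^2^2) \<Rightarrow> real^2 \<Rightarrow> 2 \<Rightarrow> 2 \<Rightarrow> 2 \<Rightarrow> real" where
  "christoffel G z k i j =
     1/2 * (\<Sum>l\<in>UNIV. matrix_inv (G z) $ k $ l *
       (partial i (\<lambda>w. G w $ j $ l) z + partial j (\<lambda>w. G w $ i $ l) z - partial l (\<lambda>w. G w $ i $ j) z))"

definition velocity :: "'a chart \<Rightarrow> (real \<Rightarrow> 'a) \<Rightarrow> real set \<Rightarrow> real \<Rightarrow> real^2" where
  "velocity c \<gamma> I t = vector_derivative (snd c \<circ> \<gamma>) (at t within I)"

text \<open>Affinely parametrised geodesics on a nondegenerate interval \<open>I\<close>; derivatives are one-sided at
  endpoints belonging to \<open>I\<close>.\<close>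

definition geodesic_on ::
    "'a::topological_space chart set \<Rightarrow> ('a chart \<Rightarrow> 'a \<Rightarrow> real^2^2) \<Rightarrow> real set \<Rightarrow> (real \<Rightarrow> 'a) \<Rightarrow> bool" where
  "geodesic_on A g I \<gamma> \<longleftrightarrow> continuous_on I \<gamma> \<and>
     (\<forall>c\<in>A. \<forall>t\<in>I. \<gamma> t \<in> fst c \<longrightarrow>
        (snd c \<circ> \<gamma>) differentiable (at t within I) \<and>
        (velocity c \<gamma> I has_vector_derivative
           (\<chi> k. - (\<Sum>i\<in>UNIV. \<Sum>j\<in>UNIV. christoffel (g c \<circ> chart_inv c) (snd c (\<gamma> t)) k i j *
                     velocity c \<gamma> I t $ i * velocity c \<gamma> I t $ j))) (at t within I))"

definition null_geodesic_on ::
    "'a::topological_space chart set \<Rightarrow> ('a chart \<Rightarrow> 'a \<Rightarrow> real^2^2) \<Rightarrow> real set \<Rightarrow> (real \<Rightarrow> 'a) \<Rightarrow> bool" where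
  "null_geodesic_on A g I \<gamma> \<longleftrightarrow> geodesic_on A g I \<gamma> \<and>
     (\<forall>c\<in>A. \<forall>t\<in>I. \<gamma> t \<in> fst c \<longrightarrow> bilin (g c (\<gamma> t)) (velocity c \<gamma> I t) (velocity c \<gamma> I t) = 0)"

definition null_complete ::
    "'a::topological_space chart set \<Rightarrow> ('a chart \<Rightarrow> 'a \<Rightarrow> real^2^2) \<Rightarrow> bool" where
  "null_complete A g \<longleftrightarrow>
     (\<forall>I \<gamma>. is_interval I \<and> open I \<and> I \<noteq> {} \<and> null_geodesic_on A g I \<gamma> \<longrightarrow>
        (\<exists>\<gamma>'. geodesic_on A g UNIV \<gamma>' \<and> (\<forall>t\<in>I. \<gamma>' t = \<gamma> t)))"

definition half_open :: "ereal \<Rightarrow> real set" where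
  "half_open T = {t. 0 \<le> t \<and> ereal t < T}"

definition maximal_semi_geodesic ::
    "'a::topological_space chart set \<Rightarrow> ('a chart \<Rightarrow> 'a \<Rightarrow> real^2^2) \<Rightarrow> ereal \<Rightarrow> (real \<Rightarrow> 'a) \<Rightarrow> bool" where
  "maximal_semi_geodesic A g T \<gamma> \<longleftrightarrow> 0 < T \<and> geodesic_on A g (half_open T) \<gamma> \<and>
     \<not> (\<exists>T' \<gamma>'. T < T' \<and> geodesic_on A g (half_open T') \<gamma>' \<and> (\<forall>t\<in>half_open T. \<gamma>' t = \<gamma> t))"


section \<open>Ribbons\<close>

text \<open>A null foliation is given by its tangent line field: \<open>L c p\<close> is the tangent line of the leaf
  through \<open>p\<close>, in the coordinates of \<open>c\<close>. In dimension two every smooth line field is integrable.\<close>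

definition null_foliation ::
    "'a::topological_space chart set \<Rightarrow> ('a chart \<Rightarrow> 'a \<Rightarrow> real^2^2) \<Rightarrow> ('a chart \<Rightarrow> 'a \<Rightarrow> (real^2) set) \<Rightarrow> bool" where
  "null_foliation A g L \<longleftrightarrow>
     (\<forall>c\<in>A. \<forall>p\<in>fst c. \<exists>W N. open W \<and> p \<in> W \<and> W \<subseteq> fst c \<and> smooth_on (snd c ` W) N \<and>
        (\<forall>q\<in>W. N (snd c q) \<noteq> 0 \<and> bilin (g c q) (N (snd c q)) (N (snd c q)) = 0 \<and>
               L c q = span {N (snd c q)})) \<and>
     (\<forall>c\<in>A. \<forall>d\<in>A. \<forall>p \<in> fst c \<inter> fst d. L d p = (\<lambda>v. transition_jacobian c d p *v v) ` L c p)"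

definition ribbon ::
    "'a::topological_space chart set \<Rightarrow> ('a chart \<Rightarrow> 'a \<Rightarrow> real^2^2) \<Rightarrow> ('a chart \<Rightarrow> 'a \<Rightarrow> real^2) \<Rightarrow> 'a set \<Rightarrow> bool" where
  "ribbon A g K U \<longleftrightarrow> open U \<and> simply_connected U \<and> flow_invariant A K U \<and>
     (\<forall>c\<in>A. \<forall>p \<in> U \<inter> fst c. K c p \<noteq> 0) \<and>
     (\<exists>L. null_foliation A g L \<and> (\<forall>c\<in>A. \<forall>p \<in> U \<inter> fst c. K c p \<notin> L c p))"

definition maximal_ribbon ::
    "'a::topological_space chart set \<Rightarrow> ('a chart \<Rightarrow> 'a \<Rightarrow> real^2^2) \<Rightarrow> ('a chart \<Rightarrow> 'a \<Rightarrow> real^2) \<Rightarrow> 'a set \<Rightarrow> bool" where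
  "maximal_ribbon A g K U \<longleftrightarrow> ribbon A g K U \<and> (\<forall>V. ribbon A g K V \<and> U \<subseteq> V \<longrightarrow> V = U)"

text \<open>The map \<open>\<psi>\<close> is an isometry from \<open>U\<close> onto the plane with metric \<open>2 dx dy + f(x) dy^2\<close>, sending
  \<open>K\<close> to the coordinate field of \<open>y\<close>. Since \<open>A\<close> is a maximal atlas, the diffeomorphisms from an open
  set \<open>U\<close> onto the plane are precisely the charts in \<open>A\<close> with domain \<open>U\<close> that are onto the plane.\<close>

definition Rf_isometry ::
    "'a::topological_space chart set \<Rightarrow> ('a chart \<Rightarrow> 'a \<Rightarrow> real^2^2) \<Rightarrow> ('a chart \<Rightarrow> 'a \<Rightarrow> real^2) \<Rightarrow>
     (real \<Rightarrow> real) \<Rightarrow> 'a set \<Rightarrow> ('a \<Rightarrow> real^2) \<Rightarrow> bool" where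
  "Rf_isometry A g K f U \<psi> \<longleftrightarrow> smooth_on UNIV f \<and> (U, \<psi>) \<in> A \<and> \<psi> ` U = UNIV \<and>
     (\<forall>p\<in>U. g (U, \<psi>) p = vector [vector [0, 1], vector [1, f (\<psi> p $ 1)]] \<and>
            K (U, \<psi>) p = vector [0, 1])"

definition in_semi_ribbon_unbounded ::
    "'a set \<Rightarrow> ('a \<Rightarrow> real^2) \<Rightarrow> ereal \<Rightarrow> (real \<Rightarrow> 'a) \<Rightarrow> bool" where
  "in_semi_ribbon_unbounded U \<psi> T \<gamma> \<longleftrightarrow>
     (\<forall>t\<in>half_open T. \<gamma> t \<in> U \<and> 0 \<le> \<psi> (\<gamma> t) $ 1) \<and>
     \<not> bounded ((\<lambda>t. \<psi> (\<gamma> t) $ 1) ` half_open T)"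

definition semi_ribbon_geodesics_complete ::
    "'a::topological_space chart set \<Rightarrow> ('a chart \<Rightarrow> 'a \<Rightarrow> real^2^2) \<Rightarrow> 'a set \<Rightarrow> ('a \<Rightarrow> real^2) \<Rightarrow> bool" where
  "semi_ribbon_geodesics_complete A g U \<psi> \<longleftrightarrow>
     (\<forall>T \<gamma>. maximal_semi_geodesic A g T \<gamma> \<and> in_semi_ribbon_unbounded U \<psi> T \<gamma> \<longrightarrow> T = \<infinity>)"

end

theory Submission
  imports Defs
begin

text \<open>The metric \<open>2 dx dy + f(x) dy\<^sup>2\<close> and the Killing field \<open>\<partial>\<^sub>y\<close> give every geodesic two
constants of motion: the energy \<open>E = 2 x' y' + f y'\<^sup>2\<close> and the Clairaut momentum \<open>C = x' + f y'\<close>.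
Eliminating \<open>y'\<close> leaves \<open>x'\<^sup>2 = C\<^sup>2 - E f(x)\<close>, so a geodesic needs the time
\<open>\<integral> dx / sqrt (C\<^sup>2 - E f)\<close> to travel to \<open>x = \<infinity>\<close>, and it can get there only if \<open>E f\<close> is bounded above
on the half-line. With \<open>\<epsilon>\<close> the sign of \<open>E\<close>, the alternative in the theorem says precisely that
this integral, truncated where \<open>C\<^sup>2 - E f\<close> is small, diverges, whatever the values of \<open>C\<close> and
\<open>\<bar>E\<bar>\<close>: where \<open>- \<epsilon> f\<close> is small the integrand is bounded below, where it is large the integrand is
comparable to \<open>1 / sqrt (- \<epsilon> f)\<close> (\<open>infinite_travel_time_iff\<close>).

If the integrals diverge, an incomplete geodesic of the semi-ribbon with unbounded \<open>x\<close> is impossible: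
its speed satisfies \<open>\<bar>x'\<bar> \<le> sqrt (max 1 (C\<^sup>2 - E f))\<close>, so its lifetime bounds the corresponding
integral (\<open>finite_escape_bounds_travel_time\<close>).

Conversely, let the integral converge for some \<open>\<epsilon>\<close>. Choosing \<open>C\<^sup>2\<close> well above \<open>\<epsilon> f\<close> and solving
\<open>x' = sqrt (C\<^sup>2 - \<epsilon> f)\<close>, \<open>y' = \<epsilon> / (x' + C)\<close> gives a curve that reaches \<open>x = \<infinity>\<close> in a finite time
\<open>T\<close>. Two points remain. The curve must solve the geodesic equation in all charts of the surface;
instead of transforming Christoffel symbols, one uses that energy and momentum are tensorial and that
their conservation along a curve whose velocity is independent of the Killing field \<open>K\<close> already
forces the covariant acceleration to vanish (\<open>geodesic_on_of_conserved_quantities\<close>). And the curve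
must not extend beyond \<open>T\<close>, even outside the ribbon; the limit point of an extension would make
\<open>g(K, K) = f(x)\<close> bounded along the end of the curve, hence \<open>x'\<close> bounded, whereas \<open>x\<close> tends to
infinity in finite time (\<open>field_norm_bounded_near_extension\<close>).\<close>


section \<open>Travel times on a half-line\<close>

lemma antiderivative_of_continuous:
  fixes f :: "real \<Rightarrow> real"
  assumes "continuous_on UNIV f"
  obtains F where "\<And>x. (F has_real_derivative f x) (at x)"
  using einterval_antiderivative[of "-\<infinity>" "\<infinity>" f] assms
  by (auto simp: has_real_derivative_iff_has_vector_derivative continuous_on_eq_continuous_at)

lemma travel_time_finite_iff:
  fixes \<phi> F :: "real \<Rightarrow> real"
  assumes cont: "continuous_on UNIV \<phi>" and pos: "\<And>x. 0 < \<phi> x"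
    and F: "\<And>x. (F has_real_derivative \<phi> x) (at x)"
  shows "(\<integral>\<^sup>+x\<in>{0..}. ennreal (\<phi> x) \<partial>lborel) < \<infinity> \<longleftrightarrow> bdd_above (F ` {0..})"
proof
  have meas: "\<phi> \<in> borel_measurable borel"
    using cont by (rule borel_measurable_continuous_onI)
  have mono: "F x \<le> F y" if "x \<le> y" for x y
    using F pos that by (intro DERIV_nonneg_imp_nondecreasing[of x y F]) (auto intro: less_imp_le)
  show "bdd_above (F ` {0..})" if fin: "(\<integral>\<^sup>+x\<in>{0..}. ennreal (\<phi> x) \<partial>lborel) < \<infinity>"
  proof (rule bdd_aboveI2)
    fix X :: real assume "X \<in> {0..}"
    then have "ennreal (F X - F 0) = (\<integral>\<^sup>+x. ennreal (\<phi> x) * indicator {0..X} x \<partial>lborel)"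
      using nn_integral_FTC_Icc[OF meas F, of 0 X] pos by (auto simp: less_imp_le)
    also have "\<dots> \<le> (\<integral>\<^sup>+x\<in>{0..}. ennreal (\<phi> x) \<partial>lborel)"
      by (intro nn_integral_mono) (auto split: split_indicator)
    finally have "F X - F 0 \<le> enn2real (\<integral>\<^sup>+x\<in>{0..}. ennreal (\<phi> x) \<partial>lborel)"
      using fin mono[of 0 X] \<open>X \<in> {0..}\<close> enn2real_mono by fastforce
    then show "F X \<le> F 0 + enn2real (\<integral>\<^sup>+x\<in>{0..}. ennreal (\<phi> x) \<partial>lborel)" by simp
  qed
  show "(\<integral>\<^sup>+x\<in>{0..}. ennreal (\<phi> x) \<partial>lborel) < \<infinity>" if bdd: "bdd_above (F ` {0..})"
  proof -
    define L where "L = Sup (F ` {0..})"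
    have "(F \<longlongrightarrow> L) at_top"
    proof (rule increasing_tendsto)
      show "\<forall>\<^sub>F x in at_top. F x \<le> L"
        using eventually_ge_at_top[of 0] by eventually_elim (auto simp: L_def intro: cSup_upper bdd)
      fix l assume "l < L"
      then obtain y where y: "l < F y" unfolding L_def by (auto simp: less_cSup_iff[OF _ bdd])
      show "\<forall>\<^sub>F x in at_top. l < F x"
        by (rule eventually_mono[OF eventually_ge_at_top[of y]]) (use mono y in \<open>blast intro: less_le_trans\<close>)
    qed
    then have "(\<integral>\<^sup>+x\<in>{0..}. ennreal (\<phi> x) \<partial>lborel) = ennreal (L - F 0)"
      using F pos by (intro nn_integral_FTC_atLeast[OF meas]) (auto intro: less_imp_le)
    then show ?thesis by simp
  qed
qed

text \<open>With \<open>\<phi>\<close> the time spent per unit of length, \<open>F\<close> is the arrival time and its inverse is the motion.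
The bound on \<open>F\<close> makes the motion reach infinity by a finite time \<open>T\<close>. It passes \<open>x = 1\<close> at time \<open>0\<close>
and is followed back to \<open>x = 0\<close> at a time \<open>a < 0\<close>, so that it is differentiable on both sides at
time \<open>0\<close>.\<close>

lemma motion_with_prescribed_speed:
  fixes \<phi> F :: "real \<Rightarrow> real"
  assumes pos: "\<And>x. 0 < \<phi> x" and F: "\<And>x. (F has_real_derivative \<phi> x) (at x)"
    and bdd: "bdd_above (F ` {0..})"
  shows "\<exists>\<xi> a T. a < 0 \<and> 0 < T
    \<and> (\<forall>t. a < t \<and> t < T \<longrightarrow> 0 < \<xi> t \<and> (\<xi> has_real_derivative 1 / \<phi> (\<xi> t)) (at t))
    \<and> (\<forall>x\<ge>1. \<exists>t\<ge>0. t < T \<and> \<xi> t = x)"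
proof -
  define H where "H x = F x - F 1" for x
  have DH: "(H has_real_derivative \<phi> x) (at x)" for x
    unfolding H_def using F by (auto intro!: derivative_eq_intros)
  have contH: "isCont H x" for x using DH DERIV_isCont by blast
  have H_less: "H x < H y" if "x < y" for x y
    using DH pos that by (intro DERIV_pos_imp_increasing[of x y H]) auto
  define T where "T = Sup (H ` {0..})"
  have bddH: "bdd_above (H ` {0..})"
    using bdd unfolding bdd_above_def H_def by (auto intro: diff_right_mono)
  have HT: "H x < T" if "0 \<le> x" for x
  proof -
    have "H x < H (x + 1)" by (rule H_less) simp
    also have "\<dots> \<le> T" unfolding T_def using that by (intro cSup_upper bddH) auto
    finally show ?thesis .
  qed
  define \<xi> where "\<xi> t = (THE x. 0 < x \<and> H x = t)" for t
  have \<xi>H: "\<xi> (H x) = x" if "0 < x" for x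
  proof -
    have "y = x" if "H y = H x" for y
      using that H_less[of x y] H_less[of y x] by (cases x y rule: linorder_cases) auto
    then show ?thesis unfolding \<xi>_def using that by (intro the_equality) auto
  qed
  have ex: "\<exists>x>0. H x = t" if t: "H 0 < t" "t < T" for t
  proof -
    obtain y where y: "0 \<le> y" "t < H y" using t(2) unfolding T_def by (auto simp: less_cSup_iff[OF _ bddH])
    then obtain x where "0 \<le> x" "x \<le> y" "H x = t"
      using IVT[of H 0 t y] t(1) contH by auto
    then show ?thesis using t(1) by (intro exI[of _ x]) (auto simp: less_le)
  qed
  have H\<xi>: "H (\<xi> t) = t" and \<xi>_pos: "0 < \<xi> t" if "H 0 < t" "t < T" for t
    using ex[OF that] \<xi>H by auto
  have D\<xi>: "(\<xi> has_real_derivative 1 / \<phi> (\<xi> t)) (at t)" if t: "H 0 < t" "t < T" for t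
  proof -
    let ?x = "\<xi> t"
    have "isCont \<xi> (H ?x)"
      by (rule isCont_inverse_function2[where a = "?x / 2" and b = "2 * ?x"]) (use \<xi>_pos[OF t] \<xi>H contH in auto)
    then have "(\<xi> has_real_derivative inverse (\<phi> ?x)) (at t)"
      using DH[of ?x] pos[of ?x] t H\<xi> by (intro DERIV_inverse_function[where f = H and a = "H 0" and b = T]) auto
    then show ?thesis by (simp add: divide_inverse)
  qed
  have "H 1 = 0" by (simp add: H_def)
  have reach: "\<exists>t\<ge>0. t < T \<and> \<xi> t = x" if "1 \<le> x" for x
    using that HT[of x] \<xi>H[of x] H_less[of 1 x] \<open>H 1 = 0\<close>
    by (intro exI[of _ "H x"]) (cases "x = 1"; auto)
  show ?thesis
    by (intro exI[of _ \<xi>] exI[of _ "H 0"] exI[of _ T])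
      (use H_less[of 0 1] HT[of 1] \<open>H 1 = 0\<close> \<xi>_pos D\<xi> reach in auto)
qed

lemma nonneg_unbounded_exceeds:
  fixes x :: "'b \<Rightarrow> real"
  assumes "\<And>t. t \<in> S \<Longrightarrow> 0 \<le> x t" and "\<not> bounded (x ` S)"
  shows "\<exists>t\<in>S. X < x t"
proof (rule ccontr)
  assume "\<not> (\<exists>t\<in>S. X < x t)"
  then have "\<forall>t\<in>S. norm (x t) \<le> X" using assms(1) by (auto simp: not_less)
  then show False using assms(2) unfolding bounded_iff by blast
qed

text \<open>A point with \<open>x' \<le> 1 / \<phi>(x)\<close> satisfies \<open>(F(x(t)) - t)' \<le> 0\<close>. This remains
true while \<open>x\<close> turns back or stops on its way to infinity.\<close>

lemma finite_escape_bounds_travel_time: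
  fixes \<phi> F x x' :: "real \<Rightarrow> real" and T :: real
  assumes pos: "\<And>u. 0 < \<phi> u" and F: "\<And>u. (F has_real_derivative \<phi> u) (at u)"
    and x: "\<And>t. t \<in> {0..<T} \<Longrightarrow> (x has_real_derivative x' t) (at t within {0..<T})"
    and speed: "\<And>t. t \<in> {0..<T} \<Longrightarrow> \<phi> (x t) * x' t \<le> 1"
    and nonneg: "\<And>t. t \<in> {0..<T} \<Longrightarrow> 0 \<le> x t"
    and unbounded: "\<not> bounded (x ` {0..<T})"
  shows "bdd_above (F ` {0..})"
proof (rule bdd_aboveI2)
  fix X :: real assume "X \<in> {0..}"
  have "\<exists>t\<in>{0..<T}. X < x t"
    using nonneg unbounded by (rule nonneg_unbounded_exceeds)
  then obtain t where t: "t \<in> {0..<T}" "X < x t" by blast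
  have "F X \<le> F (x t)"
    using F pos t by (intro DERIV_nonneg_imp_nondecreasing[of X "x t" F]) (auto intro: less_imp_le)
  also have "F (x t) \<le> F (x 0) + t"
  proof (cases "t = 0")
    case False
    have D: "((\<lambda>s. F (x s) - s) has_derivative (\<lambda>h. (\<phi> (x s) * x' s - 1) * h)) (at s within {0..t})"
      if "0 \<le> s" "s \<le> t" for s
    proof -
      have "s \<in> {0..<T}" using that t by auto
      then have "(x has_real_derivative x' s) (at s within {0..t})"
        by (rule has_field_derivative_subset[OF x]) (use t in auto)
      then have "((\<lambda>s. F (x s)) has_real_derivative \<phi> (x s) * x' s) (at s within {0..t})"
        by (rule DERIV_chain2[OF F])
      then have "((\<lambda>s. F (x s) - s) has_real_derivative \<phi> (x s) * x' s - 1) (at s within {0..t})"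
        by (auto intro!: derivative_eq_intros)
      then show ?thesis by (simp only: has_field_derivative_def)
    qed
    have "0 < t" using t False by simp
    then obtain s where "s \<in> {0<..<t}" "F (x t) - t - (F (x 0) - 0) = (\<phi> (x s) * x' s - 1) * (t - 0)"
      using mvt_simple[of 0 t "\<lambda>s. F (x s) - s", OF _ D] by blast
    moreover have "(\<phi> (x s) * x' s - 1) * t \<le> 0" if "s \<in> {0<..<t}"
      using speed[of s] that t by (intro mult_nonpos_nonneg) auto
    ultimately show ?thesis by simp
  qed simp
  finally show "F X \<le> F (x 0) + T" using t by simp
qed

text \<open>This is the alternative in the theorem for \<open>h = - \<epsilon> f\<close>.\<close>

definition infinite_travel_time :: "(real \<Rightarrow> real) \<Rightarrow> bool" where
  "infinite_travel_time h \<longleftrightarrow>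
     (\<exists>M>0. emeasure lborel ({x. h x \<le> M} \<inter> {0..}) = \<infinity>) \<or>
     ((\<forall>M>0. emeasure lborel ({x. h x \<le> M} \<inter> {0..}) < \<infinity>) \<and>
      (\<exists>\<alpha>>0. (\<integral>\<^sup>+x\<in>{x. h x \<ge> \<alpha>} \<inter> {0..}. ennreal (1 / sqrt (h x)) \<partial>lborel) = \<infinity>))"

text \<open>The condition on \<open>h\<close> does not depend on the constants of motion \<open>a = C\<^sup>2\<close> and \<open>b = \<bar>E\<bar>\<close>. On
\<open>h \<le> M\<close> the integrand is bounded below, so infinite measure gives divergence. On \<open>h \<ge> \<alpha>\<close> the
quotient of \<open>a + b h\<close> by \<open>h\<close> is bounded from both sides. The truncation at \<open>1\<close> keeps the integrand
continuous on the whole line.\<close>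

lemma infinite_travel_time_iff:
  fixes h :: "real \<Rightarrow> real"
  assumes cont: "continuous_on UNIV h" and "0 \<le> a" "0 < b"
  shows "infinite_travel_time h \<longleftrightarrow>
    (\<integral>\<^sup>+x\<in>{0..}. ennreal (1 / sqrt (max 1 (a + b * h x))) \<partial>lborel) = \<infinity>"
    (is "_ \<longleftrightarrow> ?I = \<infinity>")
proof
  define \<phi> where "\<phi> x = 1 / sqrt (max 1 (a + b * h x))" for x
  have meas [measurable]: "h \<in> borel_measurable borel"
    using cont by (rule borel_measurable_continuous_onI)
  have nonneg: "0 \<le> \<phi> x" for x by (simp add: \<phi>_def)
  {
    assume "infinite_travel_time h"
    then consider (measure) M where "0 < M" "emeasure lborel ({x. h x \<le> M} \<inter> {0..}) = \<infinity>"
      | (integral) \<alpha> where "0 < \<alpha>"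
        "(\<integral>\<^sup>+x\<in>{x. h x \<ge> \<alpha>} \<inter> {0..}. ennreal (1 / sqrt (h x)) \<partial>lborel) = \<infinity>"
      unfolding infinite_travel_time_def by blast
    then show "?I = \<infinity>"
    proof cases
      case measure
      define c where "c = 1 / sqrt (max 1 (a + b * M))"
      have "c > 0" by (simp add: c_def)
      have "\<infinity> = ennreal c * emeasure lborel ({x. h x \<le> M} \<inter> {0..})"
        using \<open>c > 0\<close> measure by (simp add: ennreal_mult_top)
      also have "\<dots> = (\<integral>\<^sup>+x. ennreal c * indicator ({x. h x \<le> M} \<inter> {0..}) x \<partial>lborel)"
        by (rule nn_integral_cmult_indicator[symmetric]) measurable
      also have "\<dots> \<le> (\<integral>\<^sup>+x\<in>{0..}. ennreal (\<phi> x) \<partial>lborel)"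
      proof (rule nn_integral_mono)
        fix x
        have "c \<le> \<phi> x" if "h x \<le> M"
        proof -
          have "a + b * h x \<le> a + b * M" using that \<open>0 < b\<close> by simp
          then show ?thesis unfolding c_def \<phi>_def by (intro divide_left_mono) auto
        qed
        then show "ennreal c * indicator ({x. h x \<le> M} \<inter> {0..}) x \<le> ennreal (\<phi> x) * indicator {0..} x"
          by (auto split: split_indicator intro: ennreal_leI)
      qed
      finally show ?thesis by (simp add: \<phi>_def top_unique)
    next
      case integral
      define k where "k = (a + 1) / \<alpha> + b"
      have "k > 0" using integral \<open>0 \<le> a\<close> \<open>0 < b\<close> by (simp add: k_def add_nonneg_pos)
      have "\<infinity> = ennreal (1 / sqrt k) * (\<integral>\<^sup>+x\<in>{x. h x \<ge> \<alpha>} \<inter> {0..}. ennreal (1 / sqrt (h x)) \<partial>lborel)"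
        using \<open>k > 0\<close> integral by (simp add: ennreal_mult_top)
      also have "\<dots> = (\<integral>\<^sup>+x. ennreal (1 / sqrt k) * (ennreal (1 / sqrt (h x)) * indicator ({x. h x \<ge> \<alpha>} \<inter> {0..}) x) \<partial>lborel)"
        by (rule nn_integral_cmult[symmetric]) measurable
      also have "\<dots> \<le> (\<integral>\<^sup>+x\<in>{0..}. ennreal (\<phi> x) \<partial>lborel)"
      proof (rule nn_integral_mono)
        fix x
        have "1 / sqrt k * (1 / sqrt (h x)) \<le> \<phi> x" if hx: "\<alpha> \<le> h x"
        proof -
          have "a + 1 \<le> (a + 1) / \<alpha> * h x"
            using hx integral(1) \<open>0 \<le> a\<close> mult_left_mono[of \<alpha> "h x" "(a + 1) / \<alpha>"] by simp
          moreover have "0 < b * h x" using hx integral(1) \<open>0 < b\<close> by simp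
          ultimately have "max 1 (a + b * h x) \<le> k * h x"
            using \<open>0 \<le> a\<close> by (simp add: k_def distrib_right)
          then have "1 / sqrt (k * h x) \<le> \<phi> x"
            unfolding \<phi>_def using hx integral(1) \<open>k > 0\<close> by (intro divide_left_mono) (auto simp: less_max_iff_disj)
          then show ?thesis by (simp add: real_sqrt_mult)
        qed
        then show "ennreal (1 / sqrt k) * (ennreal (1 / sqrt (h x)) * indicator ({x. h x \<ge> \<alpha>} \<inter> {0..}) x)
            \<le> ennreal (\<phi> x) * indicator {0..} x"
          using \<open>k > 0\<close> integral(1)
          by (auto split: split_indicator intro!: ennreal_leI simp: ennreal_mult'[symmetric])
      qed
      finally show ?thesis by (simp add: \<phi>_def top_unique)
    qed
  }
  {
    assume inf: "?I = \<infinity>"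
    show "infinite_travel_time h"
    proof (rule ccontr)
      assume "\<not> infinite_travel_time h"
      then have M: "emeasure lborel ({x. h x \<le> M} \<inter> {0..}) < \<infinity>" if "M > 0" for M
        using that unfolding infinite_travel_time_def by (auto simp: less_top)
      then have \<alpha>: "(\<integral>\<^sup>+x\<in>{x. h x \<ge> \<alpha>} \<inter> {0..}. ennreal (1 / sqrt (h x)) \<partial>lborel) < \<infinity>" if "\<alpha> > 0" for \<alpha>
        using that \<open>\<not> infinite_travel_time h\<close> unfolding infinite_travel_time_def by (auto simp: less_top)
      have "(\<integral>\<^sup>+x\<in>{0..}. ennreal (\<phi> x) \<partial>lborel) \<le>
          (\<integral>\<^sup>+x. indicator ({x. h x \<le> 1} \<inter> {0..}) x
            + ennreal (1 / sqrt b) * (ennreal (1 / sqrt (h x)) * indicator ({x. h x \<ge> 1} \<inter> {0..}) x) \<partial>lborel)"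
      proof (rule nn_integral_mono)
        fix x
        have "\<phi> x \<le> 1" unfolding \<phi>_def by simp
        moreover have "\<phi> x \<le> 1 / sqrt b * (1 / sqrt (h x))" if "1 \<le> h x"
        proof -
          have "\<phi> x \<le> 1 / sqrt (b * h x)"
            unfolding \<phi>_def using that \<open>0 \<le> a\<close> \<open>0 < b\<close> by (intro divide_left_mono) auto
          then show ?thesis by (simp add: real_sqrt_mult)
        qed
        ultimately show "ennreal (\<phi> x) * indicator {0..} x \<le> indicator ({x. h x \<le> 1} \<inter> {0..}) x
            + ennreal (1 / sqrt b) * (ennreal (1 / sqrt (h x)) * indicator ({x. h x \<ge> 1} \<inter> {0..}) x)"
          using \<open>0 < b\<close>
          by (auto split: split_indicator intro!: ennreal_leI add_increasing simp: ennreal_mult'[symmetric])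
      qed
      also have "\<dots> = emeasure lborel ({x. h x \<le> 1} \<inter> {0..})
          + ennreal (1 / sqrt b) * (\<integral>\<^sup>+x\<in>{x. h x \<ge> 1} \<inter> {0..}. ennreal (1 / sqrt (h x)) \<partial>lborel)"
        by (subst nn_integral_add) (auto simp: nn_integral_cmult)
      also have "\<dots> < \<infinity>" using M[of 1] \<alpha>[of 1] by (simp add: ennreal_mult_less_top)
      finally show False using inf by (simp add: \<phi>_def)
    qed
  }
qed

lemma emeasure_lborel_atLeast: "emeasure lborel {a::real..} = \<infinity>"
proof (rule ccontr)
  assume "emeasure lborel {a..} \<noteq> \<infinity>"
  then have "emeasure lborel {a..} < \<infinity>" by (simp add: less_top)
  then obtain n :: nat where "emeasure lborel {a..} < of_nat n"
    using ennreal_Ex_less_of_nat by auto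
  moreover have "emeasure lborel {a..a + real n} \<le> emeasure lborel {a..}"
    by (rule emeasure_mono) auto
  ultimately show False by (simp add: ennreal_of_nat_eq_real_of_nat)
qed

lemma travel_time_infinite_of_bounded:
  assumes "\<And>x. 0 \<le> x \<Longrightarrow> h x \<le> M"
  shows "infinite_travel_time h"
proof -
  have "{x. h x \<le> max M 1} \<inter> {0..} = {0..}" using assms by fastforce
  then show ?thesis
    unfolding infinite_travel_time_def by (intro disjI1 exI[of _ "max M 1"]) (simp add: emeasure_lborel_atLeast)
qed


section \<open>The geodesic equation from two conservation laws\<close>

lemma differentiable_vec_nth:
  "h differentiable F \<Longrightarrow> (\<lambda>x. h x $ i) differentiable F"
  unfolding differentiable_def using bounded_linear.has_derivative[OF bounded_linear_vec_nth] by blast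

lemma has_real_derivative_along_curve:
  fixes h :: "real^2 \<Rightarrow> real" and w :: "real \<Rightarrow> real^2"
  assumes h: "h differentiable (at (w t))"
    and w: "(w has_vector_derivative v) (at t within S)"
  shows "((\<lambda>s. h (w s)) has_real_derivative (\<Sum>k\<in>UNIV. partial k h (w t) * v $ k)) (at t within S)"
proof -
  let ?D = "frechet_derivative h (at (w t))"
  have D: "(h has_derivative ?D) (at (w t))"
    using h by (simp add: frechet_derivative_works)
  then have "((\<lambda>s. h (w s)) has_derivative (\<lambda>r. ?D (r *\<^sub>R v))) (at t within S)"
    using w diff_chain_within[of w "\<lambda>r. r *\<^sub>R v" t S h ?D]
    by (simp add: has_vector_derivative_def o_def has_derivative_at_withinI)
  moreover have "?D (r *\<^sub>R v) = (\<Sum>k\<in>UNIV. partial k h (w t) * v $ k) * r" for r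
  proof -
    have lin: "linear ?D" using D by (rule has_derivative_linear)
    have "?D v = ?D (\<Sum>k\<in>UNIV. v $ k *\<^sub>R axis k 1)"
      using basis_expansion[of v] by (simp add: scalar_mult_eq_scaleR)
    also have "\<dots> = (\<Sum>k\<in>UNIV. partial k h (w t) * v $ k)"
      by (simp add: linear_sum[OF lin] linear_scale[OF lin] partial_def mult.commute)
    finally show ?thesis by (simp add: linear_scale[OF lin] mult.commute)
  qed
  ultimately show ?thesis
    by (simp only: has_field_derivative_def)
qed

lemma bilin_2:
  "bilin G u v = G$1$1 * u$1 * v$1 + G$1$2 * u$1 * v$2 + G$2$1 * u$2 * v$1 + G$2$2 * u$2 * v$2"
  by (simp add: bilin_def inner_vec_def matrix_vector_mult_def sum_2 algebra_simps)

text \<open>Let \<open>q\<close> be the covector \<open>g(\<nabla>\<^sub>v v, \<cdot>)\<close>. Differentiating \<open>g(v, v) = E\<close> gives \<open>q(v) = 0\<close>.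
Differentiating \<open>g(v, V) = C\<close> gives \<open>q(V) = 0\<close>, because the remaining term \<open>g(v, \<nabla>\<^sub>v V)\<close> is half the
Lie derivative of \<open>g\<close> along \<open>V\<close> evaluated at \<open>(v, v)\<close>. Since \<open>E g(V, V) \<noteq> C\<^sup>2\<close> says that \<open>v\<close> and \<open>V\<close>
have nonzero Gram determinant, they span the plane and \<open>q = 0\<close>.\<close>

lemma geodesic_equation_of_conservation_laws:
  fixes G :: "real^2 \<Rightarrow> real^2^2" and V :: "real^2 \<Rightarrow> real^2" and w v :: "real \<Rightarrow> real^2"
  assumes dG: "\<And>i j. (\<lambda>z. G z $ i $ j) differentiable (at (w t))"
    and dV: "\<And>k. (\<lambda>z. V z $ k) differentiable (at (w t))"
    and sym: "\<And>z. z \<in> Z \<Longrightarrow> transpose (G z) = G z" "open Z" "w t \<in> Z"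
    and inv: "invertible (G (w t))"
    and killing: "\<And>i j. lie_metric V G (w t) i j = 0"
    and w: "(w has_vector_derivative v t) (at t)"
    and v: "(v has_vector_derivative a) (at t)"
    and E: "\<forall>\<^sub>F s in nhds t. bilin (G (w s)) (v s) (v s) = E"
    and C: "\<forall>\<^sub>F s in nhds t. bilin (G (w s)) (v s) (V (w s)) = C"
    and indep: "E * bilin (G (w t)) (V (w t)) (V (w t)) \<noteq> C\<^sup>2"
  shows "a = (\<chi> k. - (\<Sum>i\<in>UNIV. \<Sum>j\<in>UNIV. christoffel G (w t) k i j * v t $ i * v t $ j))"
proof -
  define g where "g i j = G (w t) $ i $ j" for i j
  define dg where "dg k i j = partial k (\<lambda>z. G z $ i $ j) (w t)" for k i j
  define dk where "dk k i = partial k (\<lambda>z. V z $ i) (w t)" for k i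
  define u where "u i = v t $ i" for i
  define K where "K i = V (w t) $ i" for i
  have G21: "G z $ 2 $ 1 = G z $ 1 $ 2" if "z \<in> Z" for z
    using arg_cong[OF sym(1)[OF that], of "\<lambda>M. M $ 1 $ 2"] by (simp add: transpose_def)
  have g21: "g 2 1 = g 1 2" using G21 sym(3) by (simp add: g_def)
  have dg21: "dg k 2 1 = dg k 1 2" for k
  proof -
    have "((\<lambda>z. G z $ 2 $ 1) has_derivative frechet_derivative (\<lambda>z. G z $ 1 $ 2) (at (w t))) (at (w t))"
      by (rule has_derivative_transform_within_open[OF _ sym(2,3)])
        (use dG G21 in \<open>auto simp: frechet_derivative_works[symmetric]\<close>)
    then show ?thesis by (simp add: dg_def partial_def frechet_derivative_at[symmetric])
  qed
  have DG: "((\<lambda>s. G (w s) $ i $ j) has_real_derivative dg 1 i j * u 1 + dg 2 i j * u 2) (at t)" for i j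
    using has_real_derivative_along_curve[OF dG w] by (simp add: sum_2 dg_def u_def)
  have DV: "((\<lambda>s. V (w s) $ i) has_real_derivative dk 1 i * u 1 + dk 2 i * u 2) (at t)" for i
    using has_real_derivative_along_curve[OF dV w] by (simp add: sum_2 dk_def u_def)
  have Dv: "((\<lambda>s. v s $ i) has_real_derivative a $ i) (at t)" for i
    using bounded_linear.has_vector_derivative[OF bounded_linear_vec_nth v]
    by (simp add: has_real_derivative_iff_has_vector_derivative)
  have zero: "d = 0" if "\<forall>\<^sub>F s in nhds t. h s = c" "(h has_real_derivative d) (at t)" for h d and c :: real
  proof -
    have "((\<lambda>_. c) has_real_derivative d) (at t)"
      using that by (subst DERIV_cong_ev[OF refl _ refl, of _ h]) (auto elim: eventually_mono)
    then show ?thesis by (rule DERIV_unique[OF _ DERIV_const])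
  qed
  define q where "q l = (\<Sum>i\<in>UNIV. g l i * a $ i) + (\<Sum>i\<in>UNIV. \<Sum>j\<in>UNIV.
     (dg i j l + dg j i l - dg l i j) / 2 * u i * u j)" for l :: 2
  have DGvv: "((\<lambda>s. bilin (G (w s)) (v s) (v s)) has_real_derivative
     (dg 1 1 1 * u 1 + dg 2 1 1 * u 2) * u 1 * u 1 + 2 * (dg 1 1 2 * u 1 + dg 2 1 2 * u 2) * u 1 * u 2
      + (dg 1 2 2 * u 1 + dg 2 2 2 * u 2) * u 2 * u 2
      + 2 * (g 1 1 * u 1 * a $ 1 + g 1 2 * (u 1 * a $ 2 + u 2 * a $ 1) + g 2 2 * u 2 * a $ 2)) (at t)"
    unfolding bilin_2
    by (rule derivative_eq_intros DG Dv refl)+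
      (simp add: g_def[symmetric] u_def[symmetric] dg21 g21 algebra_simps)
  have DGvV: "((\<lambda>s. bilin (G (w s)) (v s) (V (w s))) has_real_derivative
     (dg 1 1 1 * u 1 + dg 2 1 1 * u 2) * u 1 * K 1
      + (dg 1 1 2 * u 1 + dg 2 1 2 * u 2) * (u 1 * K 2 + u 2 * K 1)
      + (dg 1 2 2 * u 1 + dg 2 2 2 * u 2) * u 2 * K 2
      + g 1 1 * (a $ 1 * K 1 + u 1 * (dk 1 1 * u 1 + dk 2 1 * u 2))
      + g 1 2 * (a $ 1 * K 2 + a $ 2 * K 1 + u 1 * (dk 1 2 * u 1 + dk 2 2 * u 2)
          + u 2 * (dk 1 1 * u 1 + dk 2 1 * u 2))
      + g 2 2 * (a $ 2 * K 2 + u 2 * (dk 1 2 * u 1 + dk 2 2 * u 2))) (at t)"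
    unfolding bilin_2
    by (rule derivative_eq_intros DG Dv DV refl)+
      (simp add: g_def[symmetric] u_def[symmetric] K_def[symmetric] dg21 g21 algebra_simps)
  have qu: "q 1 * u 1 + q 2 * u 2 = 0"
    using zero[OF E DGvv] by (simp add: q_def sum_2 dg21 g21 field_simps)
  have qK: "q 1 * K 1 + q 2 * K 2 = 0"
  proof -
    define L where "L i j = K 1 * dg 1 i j + g 1 j * dk i 1 + g i 1 * dk j 1
        + (K 2 * dg 2 i j + g 2 j * dk i 2 + g i 2 * dk j 2)" for i j
    have L0: "L i j = 0" for i j
      using killing[of i j] by (simp add: L_def lie_metric_def sum_2 K_def g_def dg_def dk_def)
    have "q 1 * K 1 + q 2 * K 2 =
     ((dg 1 1 1 * u 1 + dg 2 1 1 * u 2) * u 1 * K 1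
      + (dg 1 1 2 * u 1 + dg 2 1 2 * u 2) * (u 1 * K 2 + u 2 * K 1)
      + (dg 1 2 2 * u 1 + dg 2 2 2 * u 2) * u 2 * K 2
      + g 1 1 * (a $ 1 * K 1 + u 1 * (dk 1 1 * u 1 + dk 2 1 * u 2))
      + g 1 2 * (a $ 1 * K 2 + a $ 2 * K 1 + u 1 * (dk 1 2 * u 1 + dk 2 2 * u 2)
          + u 2 * (dk 1 1 * u 1 + dk 2 1 * u 2))
      + g 2 2 * (a $ 2 * K 2 + u 2 * (dk 1 2 * u 1 + dk 2 2 * u 2)))
      - (L 1 1 * u 1 * u 1 + 2 * L 1 2 * u 1 * u 2 + L 2 2 * u 2 * u 2) / 2"
      by (simp add: q_def L_def sum_2 dg21 g21 field_simps)
    then show ?thesis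
      using zero[OF C DGvV] L0 by simp
  qed
  have uK: "u 1 * K 2 - u 2 * K 1 \<noteq> 0"
  proof -
    have "E = bilin (G (w t)) (v t) (v t)" "C = bilin (G (w t)) (v t) (V (w t))"
      using E C by (auto dest: eventually_nhds_x_imp_x)
    then have "E * bilin (G (w t)) (V (w t)) (V (w t)) - C\<^sup>2
        = (g 1 1 * g 2 2 - g 1 2 * g 1 2) * (u 1 * K 2 - u 2 * K 1)\<^sup>2"
      using g21 by (simp add: bilin_2 g_def[symmetric] u_def[symmetric] K_def[symmetric]
          power2_eq_square algebra_simps)
    then show ?thesis using indep by auto
  qed
  have "q 1 * (u 1 * K 2 - u 2 * K 1)
      = (q 1 * u 1 + q 2 * u 2) * K 2 - (q 1 * K 1 + q 2 * K 2) * u 2"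
    and "q 2 * (u 1 * K 2 - u 2 * K 1)
      = (q 1 * K 1 + q 2 * K 2) * u 1 - (q 1 * u 1 + q 2 * u 2) * K 1"
    by (simp_all add: algebra_simps)
  then have "q 1 * (u 1 * K 2 - u 2 * K 1) = 0" "q 2 * (u 1 * K 2 - u 2 * K 1) = 0"
    unfolding qu qK by simp_all
  then have "q 1 = 0" "q 2 = 0" using uK by auto
  then have q: "q l = 0" for l
    using exhaust_2[of l] by auto
  \<comment> \<open>Raising the index of \<open>q = 0\<close> turns it into the geodesic equation.\<close>
  define b where "b = (\<chi> l. - (\<Sum>i\<in>UNIV. \<Sum>j\<in>UNIV.
     (dg i j l + dg j i l - dg l i j) / 2 * u i * u j))"
  let ?H = "matrix_inv (G (w t))"
  have "?H ** G (w t) = mat 1"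
    using inv unfolding invertible_def matrix_inv_def by (rule someI2_ex) blast
  moreover have "G (w t) *v a = b"
  proof -
    have "(G (w t) *v a) $ l = b $ l" for l
      using q[of l] unfolding q_def by (simp add: matrix_vector_mult_def g_def b_def)
    then show ?thesis by (simp add: vec_eq_iff)
  qed
  ultimately have "a = ?H *v b"
    by (metis matrix_vector_mul_assoc matrix_vector_mul_lid)
  also have "\<dots> = (\<chi> k. - (\<Sum>i\<in>UNIV. \<Sum>j\<in>UNIV. christoffel G (w t) k i j * v t $ i * v t $ j))"
    unfolding vec_eq_iff b_def
    by (simp add: matrix_vector_mult_def sum_2 christoffel_def dg_def u_def field_simps)
  finally show ?thesis .
qed


section \<open>Change of charts\<close>

lemma smooth_on_imp_continuous_on: "smooth_on S h \<Longrightarrow> continuous_on S h"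
  unfolding smooth_on_def by (metis Ck_on.simps(1))

lemma smooth_on_imp_differentiable: "smooth_on S h \<Longrightarrow> x \<in> S \<Longrightarrow> h differentiable (at x)"
  unfolding smooth_on_def by (metis Ck_on.simps(2))

lemma smooth_on_frechet_derivative:
  "smooth_on S h \<Longrightarrow> smooth_on S (\<lambda>x. frechet_derivative h (at x) v)"
  unfolding smooth_on_def by (metis Ck_on.simps(2))

lemma bilin_congruence: "bilin (transpose J ** G ** J) u v = bilin G (J *v u) (J *v v)"
proof -
  have "u \<bullet> (transpose J *v y) = (J *v u) \<bullet> y" for y
    by (metis dot_lmul_matrix inner_commute transpose_matrix_vector)
  then show ?thesis
    unfolding bilin_def matrix_vector_mul_assoc[symmetric] by (simp only:)
qed

lemma lorentzian_form_invertible: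
  assumes "lorentzian_form G"
  shows "invertible G"
proof -
  obtain u v where uv: "bilin G u u = -1" "bilin G v v = 1" "bilin G u v = 0"
    using assms unfolding lorentzian_form_def by blast
  have "bilin G u u * bilin G v v - bilin G u v * bilin G v u = det G * (u$1 * v$2 - u$2 * v$1)\<^sup>2"
    by (simp add: bilin_2 det_2 power2_eq_square algebra_simps)
  then have "det G \<noteq> 0" using uv by auto
  then show ?thesis by (simp add: invertible_det_nz)
qed

lemma chart_inv_chart: "p \<in> fst c \<Longrightarrow> is_chart c \<Longrightarrow> chart_inv c (snd c p) = p"
  unfolding is_chart_def homeomorphism_def by simp

lemma transition_has_derivative:
  assumes "smooth_structure A" "c \<in> A" "d \<in> A" "p \<in> fst c" "p \<in> fst d"
  shows "(transition c d has_derivative (\<lambda>v. transition_jacobian c d p *v v)) (at (snd c p))"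
proof -
  have "smooth_on (snd c ` (fst c \<inter> fst d)) (transition c d)"
    using assms unfolding smooth_structure_def compatible_def by blast
  then have "transition c d differentiable (at (snd c p))"
    using assms by (auto intro: smooth_on_imp_differentiable)
  then show ?thesis
    unfolding transition_jacobian_def by (simp add: jacobian_works)
qed

lemma bilin_change_of_chart:
  assumes "lorentzian_metric A g" "c \<in> A" "d \<in> A" "p \<in> fst c" "p \<in> fst d"
  shows "bilin (g d p) (transition_jacobian c d p *v u) (transition_jacobian c d p *v v) = bilin (g c p) u v"
proof -
  have "g c p = transpose (transition_jacobian c d p) ** g d p ** transition_jacobian c d p"
    using assms unfolding lorentzian_metric_def by blast
  then show ?thesis by (simp only: bilin_congruence)
qed

lemma field_change_of_chart:
  assumes "smooth_vector_field A K" "c \<in> A" "d \<in> A" "p \<in> fst c" "p \<in> fst d"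
  shows "K d p = transition_jacobian c d p *v K c p"
  using assms unfolding smooth_vector_field_def by blast

text \<open>The constants of motion are read off in the single chart \<open>c\<close>, but they are values of tensors, so they
are conserved in every other chart \<open>d\<close>, where the previous criterion applies. A smooth
transition map carries a twice differentiable curve to a twice differentiable curve, so that the
acceleration in \<open>d\<close> exists.\<close>

lemma geodesic_on_of_conserved_quantities:
  assumes surface: "lorentzian_surface A g" and killing: "killing_field A g K"
    and c: "c \<in> A" and D: "open D" and cont: "continuous_on D \<gamma>" and \<gamma>c: "\<gamma> ` D \<subseteq> fst c"
    and z: "\<And>s. s \<in> D \<Longrightarrow> ((snd c \<circ> \<gamma>) has_vector_derivative v s) (at s)"
    and v: "\<And>s. s \<in> D \<Longrightarrow> v differentiable (at s)"
    and E: "\<And>s. s \<in> D \<Longrightarrow> bilin (g c (\<gamma> s)) (v s) (v s) = E"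
    and C: "\<And>s. s \<in> D \<Longrightarrow> bilin (g c (\<gamma> s)) (v s) (K c (\<gamma> s)) = C"
    and indep: "\<And>s. s \<in> D \<Longrightarrow> E * bilin (g c (\<gamma> s)) (K c (\<gamma> s)) (K c (\<gamma> s)) \<noteq> C\<^sup>2"
    and I: "I \<subseteq> D" and limpt: "\<And>t. t \<in> I \<Longrightarrow> at t within I \<noteq> bot"
  shows "geodesic_on A g I \<gamma>"
  unfolding geodesic_on_def
proof (intro conjI ballI impI)
  show "continuous_on I \<gamma>" using cont I by (rule continuous_on_subset)
next
  fix d t assume d: "d \<in> A" and "t \<in> I" and \<gamma>t: "\<gamma> t \<in> fst d"
  have t: "t \<in> D" using \<open>t \<in> I\<close> I by blast
  have struct: "smooth_structure A" and metric: "lorentzian_metric A g"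
    and field: "smooth_vector_field A K"
    using surface killing by (simp_all add: lorentzian_surface_def killing_field_def)
  have chart_c: "is_chart c" and chart_d: "is_chart d"
    using struct c d by (auto simp: smooth_structure_def)
  define S where "S = {s \<in> D. \<gamma> s \<in> fst d}"
  have "open S"
  proof -
    have "open (D \<inter> \<gamma> -` fst d)"
      using chart_d by (intro continuous_open_preimage cont D) (simp add: is_chart_def)
    then show ?thesis by (simp add: S_def vimage_def Int_def)
  qed
  have tS: "t \<in> S" using t \<gamma>t by (simp add: S_def)
  let ?h = "transition c d" and ?J = "\<lambda>s. transition_jacobian c d (\<gamma> s)"
  define y where "y = snd d \<circ> \<gamma>"
  define u where "u s = ?J s *v v s" for s
  have y_eq: "y s = (?h \<circ> (snd c \<circ> \<gamma>)) s" if "s \<in> D" for s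
    using that \<gamma>c by (auto simp: y_def transition_def chart_inv_chart[OF _ chart_c])
  have Dh: "(?h has_derivative (\<lambda>w. ?J s *v w)) (at ((snd c \<circ> \<gamma>) s))" if "s \<in> S" for s
    using transition_has_derivative[OF struct c d, of "\<gamma> s"] that \<gamma>c by (auto simp: S_def)
  have Dy: "(y has_vector_derivative u s) (at s)" if "s \<in> S" for s
  proof (rule has_vector_derivative_transform_within_open[OF _ D, of "?h \<circ> (snd c \<circ> \<gamma>)"])
    show "((?h \<circ> (snd c \<circ> \<gamma>)) has_vector_derivative u s) (at s)"
      using diff_chain_at[OF z[unfolded has_vector_derivative_def] Dh[OF that]] that
      by (simp add: has_vector_derivative_def u_def S_def o_def matrix_vector_mult_scaleR)
  qed (use that y_eq in \<open>auto simp: S_def\<close>)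
  have "u differentiable (at t)"
  proof -
    have smooth: "smooth_on (snd c ` (fst c \<inter> fst d)) ?h"
      using struct c d unfolding smooth_structure_def compatible_def by blast
    have zS: "(snd c \<circ> \<gamma>) s \<in> snd c ` (fst c \<inter> fst d)" if "s \<in> S" for s
      using that \<gamma>c by (auto simp: S_def)
    \<comment> \<open>The new velocity is the old one times the first partial derivatives of the transition map, which
      are themselves smooth.\<close>
    have "(\<lambda>s. \<Sum>k\<in>UNIV. v s $ k *\<^sub>R (((\<lambda>x. frechet_derivative ?h (at x) (axis k 1)) \<circ> (snd c \<circ> \<gamma>)) s))
        differentiable (at t)"
    proof (intro differentiable_sum ballI differentiable_scaleR differentiable_chain_at)
      show "(snd c \<circ> \<gamma>) differentiable at t"
        using z[OF t] by (rule differentiableI_vector)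
      show "(\<lambda>s. v s $ k) differentiable at t" for k
        using v[OF t] by (rule differentiable_vec_nth)
      show "(\<lambda>x. frechet_derivative ?h (at x) (axis k 1)) differentiable at ((snd c \<circ> \<gamma>) t)" for k
        by (rule smooth_on_imp_differentiable[OF smooth_on_frechet_derivative[OF smooth] zS[OF tS]])
    qed simp
    moreover have "(\<Sum>k\<in>UNIV. v s $ k *\<^sub>R (((\<lambda>x. frechet_derivative ?h (at x) (axis k 1)) \<circ> (snd c \<circ> \<gamma>)) s)) = u s"
      if "s \<in> S" for s
    proof -
      have "frechet_derivative ?h (at ((snd c \<circ> \<gamma>) s)) = (\<lambda>w. ?J s *v w)"
        using frechet_derivative_at[OF Dh[OF that]] by simp
      then have "(\<Sum>k\<in>UNIV. v s $ k *\<^sub>R (((\<lambda>x. frechet_derivative ?h (at x) (axis k 1)) \<circ> (snd c \<circ> \<gamma>)) s))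
          = (\<Sum>k\<in>UNIV. v s $ k *\<^sub>R (?J s *v axis k 1))"
        by simp
      also have "\<dots> = ?J s *v (\<Sum>k\<in>UNIV. v s $ k *\<^sub>R axis k 1)"
        by (simp add: matrix_vector_mult_scaleR matrix_vector_right_distrib sum_2)
      also have "(\<Sum>k\<in>UNIV. v s $ k *\<^sub>R axis k 1) = v s"
        using basis_expansion[of "v s"] by (simp add: scalar_mult_eq_scaleR)
      finally show ?thesis by (simp add: u_def)
    qed
    ultimately show ?thesis
      unfolding differentiable_def
      using has_derivative_transform_within_open[OF _ \<open>open S\<close> tS, of _ _ UNIV u] by blast
  qed
  then obtain b where Du: "(u has_vector_derivative b) (at t)"
    using vector_derivative_works by blast
  have on_S: "\<forall>\<^sub>F s in nhds t. s \<in> S"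
    using \<open>open S\<close> tS by (rule eventually_nhds_in_open)
  have inv_y: "chart_inv d (y s) = \<gamma> s" if "s \<in> S" for s
    using that chart_inv_chart[OF _ chart_d] by (simp add: S_def y_def)
  have smooth_g: "smooth_on (snd d ` fst d) (g d \<circ> chart_inv d)"
    and smooth_K: "smooth_on (snd d ` fst d) (K d \<circ> chart_inv d)"
    and lor: "\<And>p. p \<in> fst d \<Longrightarrow> lorentzian_form (g d p)"
    using metric field d unfolding lorentzian_metric_def smooth_vector_field_def by blast+
  have yt: "y t \<in> snd d ` fst d" using \<gamma>t by (simp add: y_def)
  have "b = (\<chi> k. - (\<Sum>i\<in>UNIV. \<Sum>j\<in>UNIV. christoffel (g d \<circ> chart_inv d) (y t) k i j * u t $ i * u t $ j))"
  proof (rule geodesic_equation_of_conservation_laws[where V = "K d \<circ> chart_inv d" and Z = "snd d ` fst d"])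
    show "(\<lambda>z. (g d \<circ> chart_inv d) z $ i $ j) differentiable at (y t)" for i j
      by (intro differentiable_vec_nth smooth_on_imp_differentiable[OF smooth_g yt])
    show "(\<lambda>z. (K d \<circ> chart_inv d) z $ k) differentiable at (y t)" for k
      by (intro differentiable_vec_nth smooth_on_imp_differentiable[OF smooth_K yt])
    show "transpose ((g d \<circ> chart_inv d) z) = (g d \<circ> chart_inv d) z" if "z \<in> snd d ` fst d" for z
      using that lor chart_inv_chart[OF _ chart_d] by (auto simp: lorentzian_form_def)
    show "open (snd d ` fst d)" using chart_d by (simp add: is_chart_def)
    show "invertible ((g d \<circ> chart_inv d) (y t))"
      using lor[OF \<gamma>t] inv_y[OF tS] by (simp add: lorentzian_form_invertible)
    show "lie_metric (K d \<circ> chart_inv d) (g d \<circ> chart_inv d) (y t) i j = 0" for i j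
      using killing d yt unfolding killing_field_def by blast
    have tensor: "bilin ((g d \<circ> chart_inv d) (y s)) (?J s *v x) (?J s *v x') = bilin (g c (\<gamma> s)) x x'"
      and fld: "(K d \<circ> chart_inv d) (y s) = ?J s *v K c (\<gamma> s)" if "s \<in> S" for s x x'
      using that \<gamma>c bilin_change_of_chart[OF metric c d] field_change_of_chart[OF field c d]
      by (auto simp: S_def inv_y[OF that])
    show "\<forall>\<^sub>F s in nhds t. bilin ((g d \<circ> chart_inv d) (y s)) (u s) (u s) = E"
      by (rule eventually_mono[OF on_S]) (simp only: u_def tensor, simp add: E S_def)
    show "\<forall>\<^sub>F s in nhds t. bilin ((g d \<circ> chart_inv d) (y s)) (u s) ((K d \<circ> chart_inv d) (y s)) = C"
      by (rule eventually_mono[OF on_S]) (simp only: u_def tensor fld, simp add: C S_def)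
    show "E * bilin ((g d \<circ> chart_inv d) (y t)) ((K d \<circ> chart_inv d) (y t)) ((K d \<circ> chart_inv d) (y t)) \<noteq> C\<^sup>2"
      unfolding fld[OF tS] tensor[OF tS] by (rule indep[OF t])
  qed (use yt Dy[OF tS] Du in auto)
  moreover have vel: "velocity d \<gamma> I s = u s" if "s \<in> I" "s \<in> S" for s
    unfolding velocity_def y_def[symmetric]
    by (rule vector_derivative_within[OF limpt[OF that(1)] has_vector_derivative_at_within[OF Dy[OF that(2)]]])
  moreover have "(velocity d \<gamma> I has_vector_derivative b) (at t within I)"
  proof -
    obtain e where e: "0 < e" "ball t e \<subseteq> S" using \<open>open S\<close> tS open_contains_ball by blast
    show ?thesis
      by (rule has_vector_derivative_transform_within[OF has_vector_derivative_at_within[OF Du] e(1) \<open>t \<in> I\<close>])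
        (use e vel in \<open>auto simp: dist_commute subset_iff\<close>)
  qed
  ultimately show "(velocity d \<gamma> I has_vector_derivative
      (\<chi> k. - (\<Sum>i\<in>UNIV. \<Sum>j\<in>UNIV. christoffel (g d \<circ> chart_inv d) (snd d (\<gamma> t)) k i j *
        velocity d \<gamma> I t $ i * velocity d \<gamma> I t $ j))) (at t within I)"
    using \<open>t \<in> I\<close> tS by (simp add: y_def)
  show "(snd d \<circ> \<gamma>) differentiable (at t within I)"
    using has_vector_derivative_at_within[OF Dy[OF tS]] unfolding y_def by (rule differentiableI_vector)
qed

text \<open>The function \<open>g(K, K)\<close> is continuous on the whole surface, hence bounded near the point that an
extension of the curve reaches at time \<open>\<tau>\<close>; this point need not lie in the chart \<open>c\<close>.\<close>

lemma field_norm_bounded_near_extension: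
  fixes A :: "'a::{t2_space,second_countable_topology} chart set" and \<gamma> \<gamma>' :: "real \<Rightarrow> 'a" and \<tau> :: real
  assumes surface: "lorentzian_surface A g" and field: "smooth_vector_field A K"
    and c: "c \<in> A" and \<gamma>c: "\<And>t. t \<in> {0..<\<tau>} \<Longrightarrow> \<gamma> t \<in> fst c" and "0 < \<tau>"
    and cont: "continuous_on {0..\<tau>} \<gamma>'" and ext: "\<And>t. t \<in> {0..<\<tau>} \<Longrightarrow> \<gamma>' t = \<gamma> t"
  shows "\<exists>B. \<exists>r\<in>{0..<\<tau>}. \<forall>t\<in>{r<..<\<tau>}. \<bar>bilin (g c (\<gamma> t)) (K c (\<gamma> t)) (K c (\<gamma> t))\<bar> \<le> B"
proof -
  have struct: "smooth_structure A" and metric: "lorentzian_metric A g"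
    using surface by (simp_all add: lorentzian_surface_def)
  obtain d where d: "d \<in> A" "\<gamma>' \<tau> \<in> fst d"
    using struct unfolding smooth_structure_def by blast
  have chart_d: "is_chart d" using struct d unfolding smooth_structure_def by blast
  define N where "N p = bilin (g d p) (K d p) (K d p)" for p
  have cont_chart: "continuous_on (fst d) (snd d)"
    using chart_d by (simp add: is_chart_def homeomorphism_def)
  have smooth_g: "smooth_on (snd d ` fst d) (g d \<circ> chart_inv d)"
    and smooth_K: "smooth_on (snd d ` fst d) (K d \<circ> chart_inv d)"
    using metric field d unfolding lorentzian_metric_def smooth_vector_field_def by blast+
  have pull: "continuous_on (fst d) h" if "continuous_on (snd d ` fst d) (h \<circ> chart_inv d)" for h :: "_ \<Rightarrow> 'c::topological_space"
    using continuous_on_compose[OF cont_chart that]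
    by (rule continuous_on_eq) (simp add: chart_inv_chart[OF _ chart_d])
  have contg: "continuous_on (fst d) (g d)" and contK: "continuous_on (fst d) (K d)"
    using smooth_g smooth_K by (auto intro: pull smooth_on_imp_continuous_on)
  have contN: "continuous_on (fst d) N"
    unfolding N_def bilin_2 by (intro continuous_intros contg contK)
  have "open (fst d)" using chart_d by (simp add: is_chart_def)
  then have "\<forall>\<^sub>F q in nhds (\<gamma>' \<tau>). q \<in> fst d"
    using d by (intro eventually_nhds_in_open)
  moreover have "(\<gamma>' \<longlongrightarrow> \<gamma>' \<tau>) (at \<tau> within {0..\<tau>})"
    using \<open>0 < \<tau>\<close> by (intro continuous_on_def[THEN iffD1, OF cont, rule_format]) auto
  moreover have "(N \<longlongrightarrow> N (\<gamma>' \<tau>)) (at (\<gamma>' \<tau>))"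
    using contN \<open>open (fst d)\<close> d by (metis at_within_open continuous_on_def)
  then have "(N \<longlongrightarrow> N (\<gamma>' \<tau>)) (nhds (\<gamma>' \<tau>))"
    by (simp add: tendsto_at_iff_tendsto_nhds)
  then have "\<forall>\<^sub>F q in nhds (\<gamma>' \<tau>). dist (N q) (N (\<gamma>' \<tau>)) < 1"
    by (rule tendstoD) simp
  ultimately have "\<forall>\<^sub>F t in at \<tau> within {0..\<tau>}. \<gamma>' t \<in> fst d \<and> dist (N (\<gamma>' t)) (N (\<gamma>' \<tau>)) < 1"
    unfolding filterlim_iff by (intro eventually_conj) blast+
  then obtain e where "0 < e" and e: "\<And>t. t \<in> {0..\<tau>} \<Longrightarrow> t \<noteq> \<tau> \<Longrightarrow> dist t \<tau> < e \<Longrightarrow>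
      \<gamma>' t \<in> fst d \<and> dist (N (\<gamma>' t)) (N (\<gamma>' \<tau>)) < 1"
    unfolding eventually_at by blast
  show ?thesis
  proof (intro exI bexI ballI)
    show "max 0 (\<tau> - e) \<in> {0..<\<tau>}" using \<open>0 < e\<close> \<open>0 < \<tau>\<close> by auto
    fix t assume t: "t \<in> {max 0 (\<tau> - e)<..<\<tau>}"
    then have "\<gamma> t \<in> fst d" "dist (N (\<gamma> t)) (N (\<gamma>' \<tau>)) < 1"
      using e[of t] ext[of t] by (auto simp: dist_real_def)
    moreover have "bilin (g c (\<gamma> t)) (K c (\<gamma> t)) (K c (\<gamma> t)) = N (\<gamma> t)"
      using bilin_change_of_chart[OF metric c d(1)] field_change_of_chart[OF field c d(1)] \<gamma>c[of t] t
        \<open>\<gamma> t \<in> fst d\<close> by (simp add: N_def)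
    ultimately show "\<bar>bilin (g c (\<gamma> t)) (K c (\<gamma> t)) (K c (\<gamma> t))\<bar> \<le> \<bar>N (\<gamma>' \<tau>)\<bar> + 1"
      by (simp add: dist_real_def)
  qed
qed


section \<open>Geodesics of a ribbon\<close>

abbreviation Rf_metric :: "(real \<Rightarrow> real) \<Rightarrow> real^2 \<Rightarrow> real^2^2" where
  "Rf_metric f z \<equiv> vector [vector [0, 1], vector [1, f (z $ 1)]]"

lemma bilin_Rf_metric:
  "bilin (Rf_metric f z) u v = u $ 1 * v $ 2 + u $ 2 * v $ 1 + f (z $ 1) * u $ 2 * v $ 2"
  by (simp add: bilin_2)

lemma matrix_inv_Rf_metric:
  "matrix_inv (Rf_metric f z) = vector [vector [- f (z $ 1), 1], vector [1, 0]]" (is "matrix_inv ?G = ?H")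
proof -
  have 1: "?G ** ?H = mat 1" and 2: "?H ** ?G = mat 1"
    by (simp_all add: vec_eq_iff forall_2 matrix_matrix_mult_def sum_2 mat_def)
  have inv: "matrix_inv ?G ** ?G = mat 1"
    unfolding matrix_inv_def by (rule someI2[of _ ?H]) (use 1 2 in auto)
  have "matrix_inv ?G = matrix_inv ?G ** (?G ** ?H)" by (simp only: 1 matrix_mul_rid)
  also have "\<dots> = ?H" by (simp only: matrix_mul_assoc inv matrix_mul_lid)
  finally show ?thesis .
qed

lemma partial_Rf_metric:
  assumes "(f has_real_derivative f') (at (z $ 1))"
  shows "partial k (\<lambda>w. Rf_metric f w $ i $ j) z = (if k = 1 \<and> i = 2 \<and> j = 2 then f' else 0)"
proof -
  have "((\<lambda>w. f (w $ 1)) has_derivative (\<lambda>h. f' * h $ 1)) (at z)"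
    using has_derivative_compose[OF bounded_linear_imp_has_derivative[OF bounded_linear_vec_nth]
        assms[unfolded has_field_derivative_def]] .
  then have f: "frechet_derivative (\<lambda>w. f (w $ 1)) (at z) = (\<lambda>h. f' * h $ 1)"
    by (rule frechet_derivative_at[symmetric])
  show ?thesis
    using exhaust_2[of i] exhaust_2[of j] exhaust_2[of k] by (auto simp: partial_def f axis_def)
qed

lemma christoffel_Rf_metric:
  fixes v :: "real^2"
  assumes "(f has_real_derivative f') (at (z $ 1))"
  shows "(\<Sum>i\<in>UNIV. \<Sum>j\<in>UNIV. christoffel (Rf_metric f) z 1 i j * v $ i * v $ j)
      = f' * v $ 1 * v $ 2 + f (z $ 1) * f' / 2 * (v $ 2)\<^sup>2"
    and "(\<Sum>i\<in>UNIV. \<Sum>j\<in>UNIV. christoffel (Rf_metric f) z 2 i j * v $ i * v $ j) = - f' / 2 * (v $ 2)\<^sup>2"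
  by (simp_all add: christoffel_def sum_2 matrix_inv_Rf_metric partial_Rf_metric[OF assms]
      power2_eq_square field_simps)

lemma Rf_isometry_chart_inv:
  assumes "is_chart (U, \<psi>)" "Rf_isometry A g K f U \<psi>"
  shows "chart_inv (U, \<psi>) z \<in> U" "\<psi> (chart_inv (U, \<psi>) z) = z"
proof -
  have "z \<in> \<psi> ` U" using assms by (simp add: Rf_isometry_def)
  then show "chart_inv (U, \<psi>) z \<in> U" "\<psi> (chart_inv (U, \<psi>) z) = z"
    by (simp_all add: chart_inv_def inv_into_into f_inv_into_f)
qed

lemma Rf_isometry_metric:
  assumes "is_chart (U, \<psi>)" "Rf_isometry A g K f U \<psi>"
  shows "g (U, \<psi>) \<circ> chart_inv (U, \<psi>) = Rf_metric f"
  using Rf_isometry_chart_inv[OF assms] assms by (auto simp: Rf_isometry_def fun_eq_iff)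

lemma Rf_isometry_DERIV:
  assumes "Rf_isometry A g K f U \<psi>"
  obtains f' where "\<And>x. (f has_real_derivative f' x) (at x)"
proof -
  have "f differentiable (at x)" for x
    using assms smooth_on_imp_differentiable unfolding Rf_isometry_def by blast
  then show ?thesis using that unfolding real_differentiable_def by metis
qed

text \<open>With \<open>C = x' + f y'\<close> and \<open>E = 2 x' y' + f y'\<^sup>2\<close> one has
\<open>C\<^sup>2 - E f = (x' + f y')\<^sup>2 - f (2 x' y' + f y'\<^sup>2) = x'\<^sup>2\<close>.\<close>

lemma geodesic_in_Rf_first_integral:
  assumes chart: "is_chart (U, \<psi>)" and iso: "Rf_isometry A g K f U \<psi>"
    and geo: "geodesic_on A g I \<gamma>" and I: "convex I" and U: "\<gamma> ` I \<subseteq> U"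
  shows "\<exists>x' C E. \<forall>t\<in>I. ((\<lambda>t. \<psi> (\<gamma> t) $ 1) has_real_derivative x' t) (at t within I) \<and>
    (x' t)\<^sup>2 = C\<^sup>2 - E * f (\<psi> (\<gamma> t) $ 1)"
proof -
  obtain f' where f': "\<And>x. (f has_real_derivative f' x) (at x)"
    using Rf_isometry_DERIV[OF iso] by blast
  let ?c = "(U, \<psi>)"
  define v where "v = velocity ?c \<gamma> I"
  define x where "x t = \<psi> (\<gamma> t) $ 1" for t
  have c: "?c \<in> A" using iso by (simp add: Rf_isometry_def)
  have geo_c: "(\<psi> \<circ> \<gamma>) differentiable (at t within I)"
    "(v has_vector_derivative (\<chi> k. - (\<Sum>i\<in>UNIV. \<Sum>j\<in>UNIV.
       christoffel (Rf_metric f) (\<psi> (\<gamma> t)) k i j * v t $ i * v t $ j))) (at t within I)" if "t \<in> I" for t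
    using geo that U c unfolding geodesic_on_def v_def Rf_isometry_metric[OF chart iso, symmetric]
    by fastforce+
  have nth: "((\<lambda>s. h s $ i) has_real_derivative d $ i) (at t within I)"
    if "(h has_vector_derivative d) (at t within I)" for h d t and i :: 2
    using bounded_linear.has_vector_derivative[OF bounded_linear_vec_nth that]
    by (simp add: has_real_derivative_iff_has_vector_derivative)
  have Dx: "(x has_real_derivative v t $ 1) (at t within I)" if "t \<in> I" for t
    using nth[OF iffD1[OF vector_derivative_works geo_c(1)[OF that]], of 1]
    by (simp add: v_def velocity_def x_def[abs_def] o_def)
  have Dv1: "((\<lambda>s. v s $ 1) has_real_derivative - (f' (x t) * v t $ 1 * v t $ 2 + f (x t) * f' (x t) / 2 * (v t $ 2)\<^sup>2))
      (at t within I)"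
    and Dv2: "((\<lambda>s. v s $ 2) has_real_derivative f' (x t) / 2 * (v t $ 2)\<^sup>2) (at t within I)" if "t \<in> I" for t
    using nth[OF geo_c(2)[OF that], of 1] nth[OF geo_c(2)[OF that], of 2]
    by (simp_all add: christoffel_Rf_metric[OF f'] x_def)
  have Df: "((\<lambda>s. f (x s)) has_real_derivative f' (x t) * v t $ 1) (at t within I)" if "t \<in> I" for t
    by (rule DERIV_chain2[OF f' Dx[OF that]])
  have "\<exists>C. \<forall>t\<in>I. v t $ 1 + f (x t) * v t $ 2 = C"
    by (rule has_field_derivative_zero_constant[OF I],
        rule DERIV_cong[OF DERIV_add[OF Dv1 DERIV_mult'[OF Df Dv2]]])
      (simp_all add: power2_eq_square field_simps)
  then obtain C where C: "\<And>t. t \<in> I \<Longrightarrow> v t $ 1 + f (x t) * v t $ 2 = C" by blast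
  have "\<exists>E. \<forall>t\<in>I. 2 * v t $ 1 * v t $ 2 + f (x t) * (v t $ 2)\<^sup>2 = E"
    by (rule has_field_derivative_zero_constant[OF I], simp only: power2_eq_square,
        rule DERIV_cong[OF DERIV_add[OF DERIV_mult'[OF DERIV_cmult[OF Dv1] Dv2]
          DERIV_mult'[OF Df DERIV_mult'[OF Dv2 Dv2]]]])
      (simp_all add: power2_eq_square field_simps)
  then obtain E where E: "\<And>t. t \<in> I \<Longrightarrow> 2 * v t $ 1 * v t $ 2 + f (x t) * (v t $ 2)\<^sup>2 = E" by blast
  have "(v t $ 1)\<^sup>2 = C\<^sup>2 - E * f (x t)" if "t \<in> I" for t
    unfolding C[OF that, symmetric] E[OF that, symmetric] by (simp add: power2_eq_square algebra_simps)
  with Dx show ?thesis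
    unfolding x_def[abs_def] by (intro exI[of _ "\<lambda>t. v t $ 1"] exI[of _ C] exI[of _ E]) simp
qed


section \<open>Completeness of the semi-ribbon\<close>

lemma half_open_ereal: "half_open (ereal T) = {0..<T}"
  by (auto simp: half_open_def)

text \<open>The sign \<open>\<epsilon>\<close> to which the hypothesis applies is that of the energy \<open>E\<close>. Null geodesics, with \<open>E = 0\<close>,
move at constant speed in \<open>x\<close> and cannot escape in finite time.\<close>

lemma semi_ribbon_geodesics_complete_if:
  assumes chart: "is_chart (U, \<psi>)" and iso: "Rf_isometry A g K f U \<psi>"
    and slow: "\<And>\<epsilon>. \<epsilon> \<in> {1, -1} \<Longrightarrow> (SUP x\<in>{0..}. ereal (\<epsilon> * f x)) < \<infinity> \<Longrightarrow> infinite_travel_time (\<lambda>x. - \<epsilon> * f x)"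
  shows "semi_ribbon_geodesics_complete A g U \<psi>"
  unfolding semi_ribbon_geodesics_complete_def
proof (intro allI impI)
  fix T \<gamma> assume "maximal_semi_geodesic A g T \<gamma> \<and> in_semi_ribbon_unbounded U \<psi> T \<gamma>"
  then have "0 < T" and geo: "geodesic_on A g (half_open T) \<gamma>"
    and in_U: "\<And>t. t \<in> half_open T \<Longrightarrow> \<gamma> t \<in> U"
    and nonneg: "\<And>t. t \<in> half_open T \<Longrightarrow> 0 \<le> \<psi> (\<gamma> t) $ 1"
    and unbounded: "\<not> bounded ((\<lambda>t. \<psi> (\<gamma> t) $ 1) ` half_open T)"
    unfolding maximal_semi_geodesic_def in_semi_ribbon_unbounded_def by auto
  show "T = \<infinity>"
  proof (rule ccontr)
    assume "T \<noteq> \<infinity>"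
    then obtain \<tau> where T: "T = ereal \<tau>" using \<open>0 < T\<close> by (cases T) auto
    then have "0 < \<tau>" using \<open>0 < T\<close> by simp
    have half: "half_open T = {0..<\<tau>}" by (simp add: T half_open_ereal)
    define x where "x t = \<psi> (\<gamma> t) $ 1" for t
    have conv: "convex (half_open T)" and img: "\<gamma> ` half_open T \<subseteq> U"
      using in_U by (auto simp: half)
    obtain x' C E where x': "\<forall>t\<in>half_open T.
        ((\<lambda>t. \<psi> (\<gamma> t) $ 1) has_real_derivative x' t) (at t within half_open T) \<and>
        (x' t)\<^sup>2 = C\<^sup>2 - E * f (\<psi> (\<gamma> t) $ 1)"
      using geodesic_in_Rf_first_integral[OF chart iso geo conv img] by blast
    have Dx: "(x has_real_derivative x' t) (at t within {0..<\<tau>})"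
      and x'2: "(x' t)\<^sup>2 = C\<^sup>2 - E * f (x t)" if "t \<in> {0..<\<tau>}" for t
      using x' that by (simp_all add: half x_def[abs_def])
    obtain f' where "\<And>x. (f has_real_derivative f' x) (at x)" using Rf_isometry_DERIV[OF iso] by blast
    then have contf: "continuous_on UNIV f" by (rule DERIV_continuous_on)
    define \<phi> where "\<phi> u = 1 / sqrt (max 1 (C\<^sup>2 - E * f u))" for u
    have cont\<phi>: "continuous_on UNIV \<phi>"
      unfolding \<phi>_def by (intro continuous_intros contf) (auto simp: less_max_iff_disj)
    have pos: "0 < \<phi> u" for u by (simp add: \<phi>_def less_max_iff_disj)
    obtain F where F: "\<And>u. (F has_real_derivative \<phi> u) (at u)"
      using antiderivative_of_continuous[OF cont\<phi>] by blast
    have "bdd_above (F ` {0..})"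
    proof (rule finite_escape_bounds_travel_time[OF pos F Dx])
      fix t assume t: "t \<in> {0..<\<tau>}"
      have "\<bar>x' t\<bar> \<le> sqrt (max 1 ((x' t)\<^sup>2))"
        by (metis max.cobounded2 real_sqrt_abs real_sqrt_le_iff)
      then show "\<phi> (x t) * x' t \<le> 1"
        unfolding \<phi>_def x'2[OF t, symmetric] by (simp add: divide_le_eq less_max_iff_disj)
      show "0 \<le> x t" using nonneg[of t] t by (simp add: half x_def)
    qed (use unbounded in \<open>simp_all add: half x_def[abs_def]\<close>)
    then have fin: "(\<integral>\<^sup>+u\<in>{0..}. ennreal (\<phi> u) \<partial>lborel) < \<infinity>"
      using travel_time_finite_iff[OF cont\<phi> pos F] by blast
    have time: "\<not> infinite_travel_time h" if "0 < b" "\<And>u. b * h u = - E * f u" "continuous_on UNIV h" for b h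
      using infinite_travel_time_iff[OF that(3), of "C\<^sup>2" b] fin that(1,2) by (auto simp: \<phi>_def)
    have "E \<noteq> 0"
    proof
      assume "E = 0"
      then have "\<not> infinite_travel_time (\<lambda>_. 0)" using time[of 1 "\<lambda>_. 0"] by simp
      then show False using travel_time_infinite_of_bounded[of "\<lambda>_. 0" 0] by simp
    qed
    define \<epsilon> where "\<epsilon> = sgn E"
    have \<epsilon>: "\<epsilon> \<in> {1, -1}" using \<open>E \<noteq> 0\<close> by (auto simp: \<epsilon>_def sgn_real_def)
    have E\<epsilon>: "\<bar>E\<bar> * \<epsilon> = E" by (simp add: \<epsilon>_def sgn_real_def)
    \<comment> \<open>Beyond its starting point the geodesic passes through every \<open>X\<close>, where \<open>C\<^sup>2 - E f(X) = x'\<^sup>2 \<ge> 0\<close>.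
      Thus \<open>\<epsilon> f\<close> is bounded above on the half-line, as the hypothesis requires.\<close>
    have far: "\<epsilon> * f X \<le> C\<^sup>2 / \<bar>E\<bar>" if "x 0 \<le> X" for X
    proof -
      have "\<exists>t\<in>{0..<\<tau>}. X < x t"
        by (rule nonneg_unbounded_exceeds) (use nonneg unbounded in \<open>simp_all add: half x_def[abs_def]\<close>)
      then obtain t where t: "t \<in> {0..<\<tau>}" "X < x t" by blast
      have "continuous_on {0..<\<tau>} x" using Dx by (rule DERIV_continuous_on)
      then have "connected (x ` {0..<\<tau>})"
        by (intro connected_continuous_image) (auto intro: convex_connected)
      then have "X \<in> x ` {0..<\<tau>}"
        using t that \<open>0 < \<tau>\<close> by (elim connectedD_interval[of _ "x 0" "x t"]) auto
      then obtain s where "s \<in> {0..<\<tau>}" "x s = X" by blast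
      then have "0 \<le> C\<^sup>2 - E * f X" using x'2[of s] zero_le_power2[of "x' s"] by simp
      then have "\<bar>E\<bar> * (\<epsilon> * f X) \<le> C\<^sup>2" by (simp add: E\<epsilon> mult.assoc[symmetric])
      then show ?thesis using \<open>E \<noteq> 0\<close> by (simp add: pos_le_divide_eq mult.commute)
    qed
    have "bounded (f ` {0..x 0})"
      by (intro compact_imp_bounded compact_continuous_image continuous_on_subset[OF contf]) auto
    then obtain B where B: "\<forall>u\<in>{0..x 0}. \<bar>f u\<bar> \<le> B"
      unfolding bounded_iff by auto
    define B' where "B' = max B (C\<^sup>2 / \<bar>E\<bar>)"
    have "\<epsilon> * f u \<le> B'" if "0 \<le> u" for u
    proof (cases "u \<le> x 0")
      case True
      then have "\<epsilon> * f u \<le> B" using bspec[OF B, of u] True that \<epsilon> by auto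
      then show ?thesis by (simp add: B'_def)
    qed (use far[of u] in \<open>simp add: B'_def\<close>)
    then have "(SUP u\<in>{0..}. ereal (\<epsilon> * f u)) \<le> ereal B'"
      by (intro SUP_least) auto
    then have slow_h: "infinite_travel_time (\<lambda>u. - \<epsilon> * f u)"
      by (intro slow[OF \<epsilon>]) (auto intro: le_less_trans)
    have scale: "\<bar>E\<bar> * (- \<epsilon> * f u) = - E * f u" for u
      using arg_cong[OF E\<epsilon>, of "\<lambda>r. - r * f u"] by (simp add: mult.assoc)
    have cont_h: "continuous_on UNIV (\<lambda>u. - \<epsilon> * f u)"
      by (intro continuous_intros contf)
    have "0 < \<bar>E\<bar>" using \<open>E \<noteq> 0\<close> by simp
    from time[OF this scale cont_h] slow_h show False by contradiction
  qed
qed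

lemma has_vector_derivative_vector_2:
  assumes "(a has_real_derivative a') (at t)" "(b has_real_derivative b') (at t)"
  shows "((\<lambda>s. vector [a s, b s] :: real^2) has_vector_derivative vector [a', b']) (at t)"
proof -
  have split: "(vector [p, q] :: real^2) = p *\<^sub>R axis 1 1 + q *\<^sub>R axis 2 1" for p q
    by (simp add: vec_eq_iff forall_2 axis_def)
  show ?thesis
    unfolding split using assms
    by (auto intro!: derivative_eq_intros simp: has_real_derivative_iff_has_vector_derivative)
qed

text \<open>If the travel time is finite, the curve with energy \<open>\<epsilon>\<close> and momentum \<open>C\<close> that starts at \<open>x = 1\<close> is an
incomplete geodesic of the semi-ribbon. Its coordinates are \<open>\<xi>\<close> with \<open>\<xi>' = \<sigma>(\<xi>)\<close>, where
\<open>\<sigma> = sqrt (C\<^sup>2 - \<epsilon> f)\<close>, and \<open>Y(\<xi>)\<close> with \<open>(Y(\<xi>))' = \<eta>(\<xi>)\<close>, where \<open>\<eta> = \<epsilon> / (\<sigma> + C)\<close> solves both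
\<open>\<sigma> + f \<eta> = C\<close> and \<open>2 \<sigma> \<eta> + f \<eta>\<^sup>2 = \<epsilon>\<close>.\<close>

lemma infinite_travel_time_if_complete:
  fixes A :: "'a::{t2_space,second_countable_topology} chart set"
  assumes surface: "lorentzian_surface A g" and killing: "killing_field A g K"
    and iso: "Rf_isometry A g K f U \<psi>"
    and complete: "semi_ribbon_geodesics_complete A g U \<psi>"
    and \<epsilon>: "\<epsilon> \<in> {1, -1}" and sup: "(SUP x\<in>{0..}. ereal (\<epsilon> * f x)) < \<infinity>"
  shows "infinite_travel_time (\<lambda>x. - \<epsilon> * f x)"
proof (rule ccontr)
  assume fast: "\<not> infinite_travel_time (\<lambda>x. - \<epsilon> * f x)"
  let ?c = "(U, \<psi>)"
  have c: "?c \<in> A" using iso by (simp add: Rf_isometry_def)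
  have field: "smooth_vector_field A K" using killing by (simp add: killing_field_def)
  have chart: "is_chart ?c" using surface c unfolding lorentzian_surface_def smooth_structure_def by blast
  obtain f' where f': "\<And>x. (f has_real_derivative f' x) (at x)" using Rf_isometry_DERIV[OF iso] by blast
  then have contf: "continuous_on UNIV f" by (rule DERIV_continuous_on)
  have "\<exists>n::nat. (SUP x\<in>{0..}. ereal (\<epsilon> * f x)) < ereal (real n)"
    using sup less_PInf_Ex_of_nat by auto
  then obtain n :: nat where n: "(SUP x\<in>{0..}. ereal (\<epsilon> * f x)) < ereal (real n)" by blast
  have n: "\<epsilon> * f x \<le> real n" if "0 \<le> x" for x
    using less_imp_le[OF le_less_trans[OF SUP_upper[of x "{0..}" "\<lambda>x. ereal (\<epsilon> * f x)"] n]] that by simp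
  \<comment> \<open>This choice makes \<open>C\<close> positive and \<open>C\<^sup>2 - \<epsilon> f \<ge> 1\<close> on the half-line, so the truncation in \<open>\<sigma>\<close> below
    is inactive where the curve lives, and \<open>x'\<close> never vanishes.\<close>
  define C where "C = real n + 1"
  define P where "P x = C\<^sup>2 - \<epsilon> * f x" for x
  have P1: "1 \<le> P x" if "0 \<le> x" for x
  proof -
    have "real n + 1 \<le> C\<^sup>2" by (simp add: C_def power2_eq_square algebra_simps)
    then show ?thesis using n[OF that] by (simp add: P_def)
  qed
  define \<sigma> where "\<sigma> x = sqrt (max 1 (P x))" for x
  have contP: "continuous_on UNIV P" unfolding P_def by (intro continuous_intros contf)
  have cont\<sigma>: "continuous_on UNIV \<sigma>" unfolding \<sigma>_def by (intro continuous_intros contP)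
  have \<sigma>1: "1 \<le> \<sigma> x" for x by (simp add: \<sigma>_def)
  have \<sigma>2: "(\<sigma> x)\<^sup>2 = P x" if "0 \<le> x" for x using P1[OF that] by (simp add: \<sigma>_def)
  have \<sigma>_pos: "0 < \<sigma> x" for x using \<sigma>1[of x] by simp
  have C_pos: "0 < C" by (simp add: C_def)
  have D\<sigma>: "\<sigma> differentiable (at x)" if "0 < x" for x
  proof -
    have "(P has_real_derivative - \<epsilon> * f' x) (at x)"
      unfolding P_def by (auto intro!: derivative_eq_intros f')
    then have "((\<lambda>x. sqrt (P x)) has_real_derivative inverse (sqrt (P x)) / 2 * (- \<epsilon> * f' x)) (at x)"
      using P1[of x] that by (intro DERIV_chain2[OF DERIV_real_sqrt]) auto
    then have "(\<sigma> has_real_derivative inverse (sqrt (P x)) / 2 * (- \<epsilon> * f' x)) (at x)"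
      by (rule has_field_derivative_transform_within_open[where S = "{0<..}"]) (use that P1 in \<open>auto simp: \<sigma>_def\<close>)
    then show ?thesis using real_differentiable_def by blast
  qed
  define \<phi> where "\<phi> x = 1 / \<sigma> x" for x
  have cont\<phi>: "continuous_on UNIV \<phi>"
    unfolding \<phi>_def using \<sigma>_pos by (intro continuous_intros cont\<sigma>) (auto simp: less_le)
  have \<phi>_pos: "0 < \<phi> x" for x by (simp add: \<phi>_def \<sigma>_pos)
  obtain F where F: "\<And>x. (F has_real_derivative \<phi> x) (at x)"
    using antiderivative_of_continuous[OF cont\<phi>] by blast
  have conth: "continuous_on UNIV (\<lambda>x. - \<epsilon> * f x)" by (intro continuous_intros contf)
  have "(\<integral>\<^sup>+x\<in>{0..}. ennreal (\<phi> x) \<partial>lborel) \<noteq> \<infinity>"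
    using infinite_travel_time_iff[OF conth, of "C\<^sup>2" 1] fast by (simp add: \<phi>_def \<sigma>_def P_def)
  then have bdd: "bdd_above (F ` {0..})"
    using travel_time_finite_iff[OF cont\<phi> \<phi>_pos F] by (simp add: less_top)
  obtain \<xi> a T where "a < 0" "0 < T"
    and motion: "\<forall>t. a < t \<and> t < T \<longrightarrow> 0 < \<xi> t \<and> (\<xi> has_real_derivative 1 / \<phi> (\<xi> t)) (at t)"
    and reach: "\<forall>x\<ge>1. \<exists>t\<ge>0. t < T \<and> \<xi> t = x"
    using motion_with_prescribed_speed[OF \<phi>_pos F bdd] by blast
  have \<xi>_pos: "0 < \<xi> t" if "a < t" "t < T" for t using motion that by blast
  have D\<xi>: "(\<xi> has_real_derivative \<sigma> (\<xi> t)) (at t)" if "a < t" "t < T" for t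
    using motion that by (simp add: \<phi>_def)
  define D where "D = {a<..<T}"
  define \<eta> where "\<eta> x = \<epsilon> / (\<sigma> x + C)" for x
  have "continuous_on UNIV (\<lambda>x. \<eta> x / \<sigma> x)"
    unfolding \<eta>_def using \<sigma>_pos C_pos
    by (intro continuous_intros cont\<sigma>) (auto simp: add_pos_pos less_imp_neq[symmetric])
  then obtain Y where Y: "\<And>x. (Y has_real_derivative \<eta> x / \<sigma> x) (at x)"
    using antiderivative_of_continuous by blast
  define z :: "real \<Rightarrow> real^2" where "z t = vector [\<xi> t, Y (\<xi> t)]" for t
  define v :: "real \<Rightarrow> real^2" where "v t = vector [\<sigma> (\<xi> t), \<eta> (\<xi> t)]" for t
  define \<gamma> where "\<gamma> t = chart_inv ?c (z t)" for t
  have \<gamma>U: "\<gamma> t \<in> U" and \<psi>\<gamma>: "\<psi> (\<gamma> t) = z t" for t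
    using Rf_isometry_chart_inv[OF chart iso] by (simp_all add: \<gamma>_def)
  have Dz: "(z has_vector_derivative v t) (at t)" if "t \<in> D" for t
    unfolding z_def[abs_def] v_def
  proof (rule has_vector_derivative_vector_2)
    have t: "a < t" "t < T" using that by (auto simp: D_def)
    show "(\<xi> has_real_derivative \<sigma> (\<xi> t)) (at t)" by (rule D\<xi>[OF t])
    show "((\<lambda>s. Y (\<xi> s)) has_real_derivative \<eta> (\<xi> t)) (at t)"
      using DERIV_chain2[OF Y D\<xi>[OF t]] \<sigma>_pos[of "\<xi> t"] by simp
  qed
  have Dv: "v differentiable (at t)" if "t \<in> D" for t
  proof -
    have t: "a < t" "t < T" using that by (auto simp: D_def)
    obtain s where s: "(\<sigma> has_real_derivative s) (at (\<xi> t))"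
      using D\<sigma>[OF \<xi>_pos[OF t]] real_differentiable_def by blast
    have 1: "((\<lambda>t. \<sigma> (\<xi> t)) has_real_derivative s * \<sigma> (\<xi> t)) (at t)"
      by (rule DERIV_chain2[OF s D\<xi>[OF t]])
    have "\<sigma> (\<xi> t) + C \<noteq> 0" using \<sigma>_pos[of "\<xi> t"] C_pos by simp
    then have "\<exists>e. ((\<lambda>t. \<eta> (\<xi> t)) has_real_derivative e) (at t)"
      unfolding \<eta>_def by (intro exI) (rule derivative_eq_intros 1 refl | assumption)+
    then show ?thesis
      using has_vector_derivative_vector_2[OF 1] unfolding v_def[abs_def] by (blast intro: differentiableI_vector)
  qed
  have gc: "g ?c (\<gamma> t) = Rf_metric f (z t)" and Kc: "K ?c (\<gamma> t) = vector [0, 1]" for t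
    using iso \<gamma>U[of t] \<psi>\<gamma>[of t] unfolding Rf_isometry_def by auto
  have key: "\<eta> (\<xi> t) * (\<sigma> (\<xi> t) + C) = \<epsilon>" "\<epsilon> * f (\<xi> t) = (C - \<sigma> (\<xi> t)) * (C + \<sigma> (\<xi> t))" if "t \<in> D" for t
  proof -
    have "\<sigma> (\<xi> t) + C \<noteq> 0" using \<sigma>_pos[of "\<xi> t"] C_pos by simp
    then show "\<eta> (\<xi> t) * (\<sigma> (\<xi> t) + C) = \<epsilon>" by (simp add: \<eta>_def)
    show "\<epsilon> * f (\<xi> t) = (C - \<sigma> (\<xi> t)) * (C + \<sigma> (\<xi> t))"
      using \<sigma>2[of "\<xi> t"] \<xi>_pos[of t] that by (simp add: D_def P_def power2_eq_square algebra_simps)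
  qed
  have f\<eta>: "f (\<xi> t) * \<eta> (\<xi> t) = C - \<sigma> (\<xi> t)" if "t \<in> D" for t
  proof -
    have "\<sigma> (\<xi> t) + C \<noteq> 0" using \<sigma>_pos[of "\<xi> t"] C_pos by simp
    then show ?thesis using key(2)[OF that] by (simp add: \<eta>_def field_simps)
  qed
  have norm_K: "bilin (g ?c (\<gamma> t)) (K ?c (\<gamma> t)) (K ?c (\<gamma> t)) = f (\<xi> t)" for t
    unfolding gc Kc bilin_Rf_metric by (simp add: z_def)
  have cont\<gamma>: "continuous_on D \<gamma>"
  proof -
    have "continuous_on UNIV (chart_inv ?c)"
      using chart iso by (simp add: is_chart_def homeomorphism_def Rf_isometry_def)
    moreover have "continuous_on D z"
      using Dz by (meson continuous_at_imp_continuous_on has_vector_derivative_continuous)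
    ultimately show ?thesis
      unfolding \<gamma>_def by (metis continuous_on_compose2 subset_UNIV)
  qed
  have geo: "geodesic_on A g {0..<T} \<gamma>"
  proof (rule geodesic_on_of_conserved_quantities[OF surface killing c _ cont\<gamma>, where v = v and E = \<epsilon> and C = C])
    show "open D" by (simp add: D_def)
    show "\<gamma> ` D \<subseteq> fst ?c" using \<gamma>U by auto
    show "(snd ?c \<circ> \<gamma> has_vector_derivative v s) (at s)" if "s \<in> D" for s
      using Dz[OF that] by (simp add: o_def \<psi>\<gamma>)
    show "v differentiable (at s)" if "s \<in> D" for s by (rule Dv[OF that])
    show "bilin (g ?c (\<gamma> s)) (v s) (v s) = \<epsilon>" if "s \<in> D" for s
    proof -
      have "bilin (g ?c (\<gamma> s)) (v s) (v s) = \<eta> (\<xi> s) * (2 * \<sigma> (\<xi> s) + f (\<xi> s) * \<eta> (\<xi> s))"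
        unfolding gc bilin_Rf_metric by (simp add: z_def v_def algebra_simps)
      also have "\<dots> = \<epsilon>" unfolding f\<eta>[OF that] using key(1)[OF that] by (simp add: algebra_simps)
      finally show ?thesis .
    qed
    show "bilin (g ?c (\<gamma> s)) (v s) (K ?c (\<gamma> s)) = C" if "s \<in> D" for s
      unfolding gc Kc bilin_Rf_metric using f\<eta>[OF that] by (simp add: z_def v_def)
    show "\<epsilon> * bilin (g ?c (\<gamma> s)) (K ?c (\<gamma> s)) (K ?c (\<gamma> s)) \<noteq> C\<^sup>2" if "s \<in> D" for s
      unfolding norm_K key(2)[OF that] using \<sigma>_pos[of "\<xi> s"] by (simp add: power2_eq_square algebra_simps)
    show "{0..<T} \<subseteq> D" using \<open>a < 0\<close> by (auto simp: D_def)
    show "at t within {0..<T} \<noteq> bot" if "t \<in> {0..<T}" for t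
      using that \<open>0 < T\<close> by (simp add: trivial_limit_within islimpt_Ico)
  qed
  \<comment> \<open>An extension to time \<open>T\<close> would bound \<open>f\<close>, hence the speed \<open>\<sigma>\<close>, on the last part of the curve,
    and \<open>\<xi>\<close> would stay bounded in finite time.\<close>
  have not_ext: False if T': "ereal T < T'" and geo': "geodesic_on A g (half_open T') \<gamma>'" and ext: "\<forall>t\<in>{0..<T}. \<gamma>' t = \<gamma> t" for T' \<gamma>'
  proof -
    have "{0..T} \<subseteq> half_open T'"
      using T' le_less_trans[of "ereal _" "ereal T" T'] by (auto simp: half_open_def)
    then have cont': "continuous_on {0..T} \<gamma>'"
      using geo' unfolding geodesic_on_def by (blast intro: continuous_on_subset)
    obtain B t0 where t0: "0 \<le> t0" "t0 < T"
      and B: "\<forall>t\<in>{t0<..<T}. \<bar>bilin (g ?c (\<gamma> t)) (K ?c (\<gamma> t)) (K ?c (\<gamma> t))\<bar> \<le> B"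
      using field_norm_bounded_near_extension[OF surface field c _ \<open>0 < T\<close> cont', of \<gamma>] \<gamma>U ext by auto
    have f_le: "\<bar>f (\<xi> t)\<bar> \<le> B" if "t0 < t" "t < T" for t using B that by (simp add: norm_K)
    define S where "S = sqrt (max 1 (C\<^sup>2 + B))"
    have "S \<ge> 1" by (simp add: S_def)
    have speed: "\<sigma> (\<xi> t) \<le> S" if "t0 < t" "t < T" for t
    proof -
      have "P (\<xi> t) \<le> C\<^sup>2 + B" using f_le[OF that] \<epsilon> by (auto simp: P_def)
      then show ?thesis by (simp add: \<sigma>_def S_def max.coboundedI2)
    qed
    have mono: "\<xi> s \<le> \<xi> t" if "0 \<le> s" "s \<le> t" "t < T" for s t
      using that \<open>a < 0\<close> \<sigma>_pos by (intro DERIV_nonneg_imp_nondecreasing[of s t \<xi>]) (auto intro!: D\<xi> exI less_imp_le)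
    define t1 where "t1 = (t0 + T) / 2"
    have t1: "t0 < t1" "t1 < T" "0 \<le> t1" using t0 by (auto simp: t1_def)
    have bound: "\<xi> t \<le> \<xi> t1 + S * T" if "0 \<le> t" "t < T" for t
    proof (cases "t \<le> t1")
      case True
      then have "\<xi> t \<le> \<xi> t1" using mono that t1 by simp
      then show ?thesis using \<open>S \<ge> 1\<close> \<open>0 < T\<close> by (simp add: add_increasing2)
    next
      case False
      have "\<exists>s>t1. s < t \<and> \<xi> t - \<xi> t1 = (t - t1) * \<sigma> (\<xi> s)"
        using False t1 that \<open>a < 0\<close> by (intro MVT2 D\<xi>) auto
      then obtain s where s: "t1 < s" "s < t" "\<xi> t - \<xi> t1 = (t - t1) * \<sigma> (\<xi> s)" by blast
      have "(t - t1) * \<sigma> (\<xi> s) \<le> T * S"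
        using s t1 that speed[of s] \<sigma>_pos[of "\<xi> s"] by (intro mult_mono) auto
      then show ?thesis using s(3) by (simp add: mult.commute)
    qed
    define X where "X = \<xi> t1 + S * T + 1"
    have "1 \<le> X" using \<xi>_pos[of t1] t1 \<open>a < 0\<close> \<open>S \<ge> 1\<close> \<open>0 < T\<close> by (simp add: X_def)
    then obtain t where "0 \<le> t" "t < T" "\<xi> t = X" using reach by blast
    then show False using bound[of t] by (simp add: X_def)
  qed
  have "maximal_semi_geodesic A g (ereal T) \<gamma>"
    using geo \<open>0 < T\<close> not_ext unfolding maximal_semi_geodesic_def half_open_ereal by auto
  moreover have "in_semi_ribbon_unbounded U \<psi> (ereal T) \<gamma>"
    unfolding in_semi_ribbon_unbounded_def half_open_ereal
  proof (intro conjI ballI notI)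
    fix t assume "t \<in> {0..<T}"
    then show "\<gamma> t \<in> U" "0 \<le> \<psi> (\<gamma> t) $ 1"
      using \<gamma>U \<xi>_pos[of t] \<open>a < 0\<close> by (auto simp: \<psi>\<gamma> z_def)
  next
    assume "bounded ((\<lambda>t. \<psi> (\<gamma> t) $ 1) ` {0..<T})"
    then obtain B where B: "\<forall>t\<in>{0..<T}. \<bar>\<xi> t\<bar> \<le> B"
      unfolding bounded_iff by (auto simp: \<psi>\<gamma> z_def)
    obtain t where t: "0 \<le> t" "t < T" "\<xi> t = \<bar>B\<bar> + 1"
      using reach[rule_format, of "\<bar>B\<bar> + 1"] by auto
    have "\<bar>\<xi> t\<bar> \<le> B" using B t(1,2) by simp
    then show False using t(3) by simp
  qed
  ultimately have "ereal T = \<infinity>"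
    using complete unfolding semi_ribbon_geodesics_complete_def by blast
  then show False by simp
qed

theorem lemma4p6:
  fixes A :: "'a::{t2_space,second_countable_topology} chart set"
    and g :: "'a chart \<Rightarrow> 'a \<Rightarrow> real^2^2"
    and K :: "'a chart \<Rightarrow> 'a \<Rightarrow> real^2"
    and f :: "real \<Rightarrow> real"
    and U :: "'a set"
    and \<psi> :: "'a \<Rightarrow> real^2"
  assumes "lorentzian_surface A g"
    and "simply_connected (UNIV :: 'a set)"
    and "null_complete A g"
    and "killing_field A g K" and "complete_field A K" and "nontrivial_field A K"
    and "maximal_ribbon A g K U"
    and "Rf_isometry A g K f U \<psi>"
  shows "(semi_ribbon_geodesics_complete A g U \<psi> \<longleftrightarrow>
      (\<forall>\<epsilon>\<in>{1, -1}. (SUP x\<in>{0..}. ereal (\<epsilon> * f x)) < \<infinity> \<longrightarrow>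
         (\<exists>M>0. emeasure lborel ({x. - \<epsilon> * f x \<le> M} \<inter> {0..}) = \<infinity>) \<or>
         ((\<forall>M>0. emeasure lborel ({x. - \<epsilon> * f x \<le> M} \<inter> {0..}) < \<infinity>) \<and>
          (\<exists>\<alpha>>0. (\<integral>\<^sup>+x\<in>{x. - \<epsilon> * f x \<ge> \<alpha>} \<inter> {0..}. ennreal (1 / sqrt (- \<epsilon> * f x)) \<partial>lborel) = \<infinity>))))
    \<and> (bounded (range f) \<longrightarrow> semi_ribbon_geodesics_complete A g U \<psi>)"
proof -
  have chart: "is_chart (U, \<psi>)"
    using assms(1,8) unfolding lorentzian_surface_def smooth_structure_def Rf_isometry_def by blast
  have iff: "semi_ribbon_geodesics_complete A g U \<psi> \<longleftrightarrow>
      (\<forall>\<epsilon>\<in>{1, -1}. (SUP x\<in>{0..}. ereal (\<epsilon> * f x)) < \<infinity> \<longrightarrow> infinite_travel_time (\<lambda>x. - \<epsilon> * f x))"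
    using semi_ribbon_geodesics_complete_if[OF chart assms(8)]
      infinite_travel_time_if_complete[OF assms(1,4,8)] by blast
  have "semi_ribbon_geodesics_complete A g U \<psi>" if bdd: "bounded (range f)"
  proof -
    obtain B where B: "\<forall>x. \<bar>f x\<bar> \<le> B" using bdd unfolding bounded_iff by auto
    have "infinite_travel_time (\<lambda>x. - \<epsilon> * f x)" if "\<epsilon> \<in> {1, -1}" for \<epsilon>
    proof (rule travel_time_infinite_of_bounded[of _ B])
      show "- \<epsilon> * f x \<le> B" for x using that spec[OF B, of x] by auto
    qed
    then show ?thesis unfolding iff by blast
  qed
  then show ?thesis using iff unfolding infinite_travel_time_def by blast
qed

end
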